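(* For any compact space $K$ the following conditions are equivalent: (i) $K$ is $NY$ compact; (ii) $K$ is Corson compact and M-scattered; (iii) $K$ is Eberlein compact and M-scattered; (iv) $K$ is hereditarily metalindelöf and M-scattered.
   Context: All spaces are assumed to be Tychonoff; in particular compact spaces are Hausdorff. "Countable weight" means having a countable base (second-countable); "countable" means of cardinality at most $\omega$. $\sigma$-product: for a family $\{X_\gamma:\gamma\in\Gamma\}$ of spaces and a point $a=(a_\gamma)_{\gamma\in\Gamma}\in\prod_{\gamma\in\Gamma}X_\gamma$, let $\sigma(\prod_{\gamma\in\Gamma}X_\gamma,a)=\{x\in\prod_{\gamma\in\Gamma}X_\gamma:\{\gamma\in\Gamma:x_\gamma\neq a_\gamma\}\text{ is finite}\}$, with the subspace topology of the product. A compact space $K$ is $NY$ compact if $K$ embeds homeomorphically into $\sigma(\prod_{\gamma\in\Gamma}X_\gamma,a)$ for some family $\{X_\gamma:\gamma\in\Gamma\}$ of compact metrizable spaces and some $a\in\prod_{\gamma\in\Gamma}X_\gamma$. A compact space is Corson compact if, for some set $\Gamma$, it is homeomorphic to a subspace of $\Sigma([0,1]^\Gamma)=\{x\in[0,1]^\Gamma:\{\gamma\in\Gamma:x_\gamma\neq0\}\text{ is countable}\}$. A compact space is Eberlein compact if it is homeomorphic to a weakly compact subset of a Banach space; equivalently, for some set $\Gamma$, it is homeomorphic to a compact subset of $\{x\in[0,1]^\Gamma:\forall\varepsilon>0\ \{\gamma\in\Gamma:x(\gamma)>\varepsilon\}\text{ is finite}\}$. A space $X$ is M-scattered if every nonempty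 subspace $A$ of $X$ contains a nonempty relatively open (in $A$) subset of countable weight. A space $X$ is metalindelöf if every open cover of $X$ has a point-countable open refinement (an open cover $\mathscr V$ of $X$, each member of which is contained in some member of the given cover, such that every point of $X$ lies in only countably many members of $\mathscr V$). A space is hereditarily metalindelöf if each of its subspaces is metalindelöf. *)

theory Defs
  imports "HOL-Analysis.Analysis"
begin

section \<open>Covering and scatteredness properties\<close>

definition M_scattered :: "'a topology \<Rightarrow> bool" where
  "M_scattered X \<longleftrightarrow>
     (\<forall>A. A \<subseteq> topspace X \<and> A \<noteq> {} \<longrightarrow>
        (\<exists>U. openin (subtopology X A) U \<and> U \<noteq> {} \<and> second_countable (subtopology X U)))"

definition metalindelof_space :: "'a topology \<Rightarrow> bool" where
  "metalindelof_space X \<longleftrightarrow>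
     (\<forall>\<U>. (\<forall>U\<in>\<U>. openin X U) \<and> \<Union>\<U> = topspace X \<longrightarrow>
        (\<exists>\<V>. (\<forall>V\<in>\<V>. openin X V) \<and> \<Union>\<V> = topspace X \<and>
              (\<forall>V\<in>\<V>. \<exists>U\<in>\<U>. V \<subseteq> U) \<and>
              (\<forall>x\<in>topspace X. countable {V \<in> \<V>. x \<in> V})))"

section \<open>Classes of compact spaces\<close>

definition sigma_product :: "'i set \<Rightarrow> ('i \<Rightarrow> 'b topology) \<Rightarrow> ('i \<Rightarrow> 'b) \<Rightarrow> ('i \<Rightarrow> 'b) topology" where
  "sigma_product \<Gamma> X a =
     subtopology (product_topology X \<Gamma>)
       {x \<in> topspace (product_topology X \<Gamma>). finite {\<gamma> \<in> \<Gamma>. x \<gamma> \<noteq> a \<gamma>}}"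

abbreviation unit_cube :: "'i set \<Rightarrow> ('i \<Rightarrow> real) topology" where
  "unit_cube \<Gamma> \<equiv> product_topology (\<lambda>_. top_of_set {0..1}) \<Gamma>"

definition Sigma_cube :: "'i set \<Rightarrow> ('i \<Rightarrow> real) topology" where
  "Sigma_cube \<Gamma> =
     subtopology (unit_cube \<Gamma>)
       {x \<in> topspace (unit_cube \<Gamma>). countable {\<gamma> \<in> \<Gamma>. x \<gamma> \<noteq> 0}}"

definition c0_cube :: "'i set \<Rightarrow> ('i \<Rightarrow> real) topology" where
  "c0_cube \<Gamma> =
     subtopology (unit_cube \<Gamma>)
       {x \<in> topspace (unit_cube \<Gamma>). \<forall>\<epsilon>>0. finite {\<gamma> \<in> \<Gamma>. x \<gamma> > \<epsilon>}}"

text \<open>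
  The definitions below say "for some set \<open>\<Gamma>\<close>" (and "for some compact metrizable spaces"), where
  the set and the spaces are arbitrary. HOL cannot quantify over types inside a formula, so the
  index sets are taken inside \<^typ>\<open>'a \<Rightarrow> real\<close>, where \<^typ>\<open>'a\<close> is the type of points of the space, and
  the compact metrizable factors are carried by subsets of \<^typ>\<open>real\<close>. This is no restriction:
  \<open>NY_compactI\<close>, \<open>Corson_compactI\<close> and \<open>Eberlein_compactI\<close> below show that an embedding over an
  index set (and factors) of any type whatsoever yields one of this form.
\<close>

definition NY_compact :: "'a topology \<Rightarrow> bool" where
  "NY_compact K \<longleftrightarrow> compact_space K \<and> Hausdorff_space K \<and>
     (\<exists>(\<Gamma> :: ('a \<Rightarrow> real) set) (X :: ('a \<Rightarrow> real) \<Rightarrow> real topology) a f.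
        (\<forall>\<gamma>\<in>\<Gamma>. compact_space (X \<gamma>) \<and> metrizable_space (X \<gamma>)) \<and>
        a \<in> topspace (product_topology X \<Gamma>) \<and>
        embedding_map K (sigma_product \<Gamma> X a) f)"

definition Corson_compact :: "'a topology \<Rightarrow> bool" where
  "Corson_compact K \<longleftrightarrow> compact_space K \<and> Hausdorff_space K \<and>
     (\<exists>(\<Gamma> :: ('a \<Rightarrow> real) set) f. embedding_map K (Sigma_cube \<Gamma>) f)"

text \<open>
  Of the two standard equivalent definitions of Eberlein compacta (weakly compact subsets of Banach
  spaces; compact subsets of \<open>c\<^sub>0(\<Gamma>) \<inter> [0,1]\<^sup>\<Gamma>\<close> with the topology of pointwise convergence), the second
  is used.
\<close>

definition Eberlein_compact :: "'a topology \<Rightarrow> bool" where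
  "Eberlein_compact K \<longleftrightarrow> compact_space K \<and> Hausdorff_space K \<and>
     (\<exists>(\<Gamma> :: ('a \<Rightarrow> real) set) f. embedding_map K (c0_cube \<Gamma>) f)"

section \<open>Independence of the chosen index types\<close>

lemma cube_embedding_reindex:
  fixes K :: "'a topology" and \<Gamma> :: "'i set"
  assumes K: "compact_space K" and f: "embedding_map K (unit_cube \<Gamma>) f"
  obtains \<Delta> :: "('a \<Rightarrow> real) set" and h r
  where "embedding_map K (unit_cube \<Delta>) h" "inj_on r \<Delta>" "r ` \<Delta> \<subseteq> \<Gamma>"
    "\<And>x d. x \<in> topspace K \<Longrightarrow> d \<in> \<Delta> \<Longrightarrow> h x d = f x (r d)"
proof -
  define c where "c \<equiv> \<lambda>\<gamma> x. if x \<in> topspace K then f x \<gamma> else 0"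
  define \<Delta> where "\<Delta> = c ` \<Gamma>"
  define r where "r = inv_into \<Gamma> c"
  define h where "h = (\<lambda>x. restrict (\<lambda>d. f x (r d)) \<Delta>)"
  have r: "r d \<in> \<Gamma>" "c (r d) = d" if "d \<in> \<Delta>" for d
    using that by (auto simp: r_def \<Delta>_def inv_into_into f_inv_into_f)
  have injr: "inj_on r \<Delta>"
    by (metis inj_on_inverseI r(2))
  have cf: "continuous_map K (unit_cube \<Gamma>) f" and injf: "inj_on f (topspace K)"
    using f by (auto simp: embedding_map_def homeomorphic_eq_everything_map continuous_map_in_subtopology)
  have ch: "continuous_map K (unit_cube \<Delta>) h"
    using cf r(1) unfolding continuous_map_componentwise
    by (auto simp: h_def)
  have "inj_on h (topspace K)"
  proof (rule inj_onI)
    fix x y assume x: "x \<in> topspace K" and y: "y \<in> topspace K" and eq: "h x = h y"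
    have "f x \<gamma> = f y \<gamma>" if "\<gamma> \<in> \<Gamma>" for \<gamma>
    proof -
      have d: "c \<gamma> \<in> \<Delta>" using that by (simp add: \<Delta>_def)
      then have "f x (r (c \<gamma>)) = f y (r (c \<gamma>))"
        using fun_cong[OF eq, of "c \<gamma>"] by (simp add: h_def)
      moreover have "c (r (c \<gamma>)) = c \<gamma>" by (rule r(2)[OF d])
      ultimately show ?thesis
        using x y by (metis c_def)
    qed
    moreover have "f x \<in> extensional \<Gamma>" "f y \<in> extensional \<Gamma>"
      using cf x y by (auto simp: continuous_map_componentwise)
    ultimately have "f x = f y" by (metis extensionalityI)
    then show "x = y" using injf x y by (meson inj_onD)
  qed
  moreover have "Hausdorff_space (unit_cube \<Delta>)"
    by (simp add: Hausdorff_space_product_topology Hausdorff_space_subtopology)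
  ultimately have "embedding_map K (unit_cube \<Delta>) h"
    using ch K by (blast intro: continuous_imp_embedding_map)
  then show thesis
    using that[of \<Delta> h r] injr r(1) by (auto simp: h_def)
qed

lemma Corson_compactI:
  fixes \<Gamma> :: "'i set"
  assumes "compact_space K" "Hausdorff_space K" "embedding_map K (Sigma_cube \<Gamma>) f"
  shows "Corson_compact K"
proof -
  have f: "embedding_map K (unit_cube \<Gamma>) f"
    and cnt: "\<And>x. x \<in> topspace K \<Longrightarrow> countable {\<gamma> \<in> \<Gamma>. f x \<gamma> \<noteq> 0}"
    using assms(3) by (auto simp: Sigma_cube_def embedding_map_in_subtopology image_subset_iff)
  obtain \<Delta> :: "('a \<Rightarrow> real) set" and h r where
    h: "embedding_map K (unit_cube \<Delta>) h" and r: "inj_on r \<Delta>" "r ` \<Delta> \<subseteq> \<Gamma>"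
    and hf: "\<And>x d. x \<in> topspace K \<Longrightarrow> d \<in> \<Delta> \<Longrightarrow> h x d = f x (r d)"
    using cube_embedding_reindex[OF assms(1) f] by blast
  have "countable {d \<in> \<Delta>. h x d \<noteq> 0}" if x: "x \<in> topspace K" for x
  proof (rule countable_image_inj_on)
    show "countable (r ` {d \<in> \<Delta>. h x d \<noteq> 0})"
      by (rule countable_subset[OF _ cnt[OF x]]) (use r hf[OF x] in auto)
    show "inj_on r {d \<in> \<Delta>. h x d \<noteq> 0}" using r(1) by (rule inj_on_subset) auto
  qed
  moreover have "h ` topspace K \<subseteq> topspace (unit_cube \<Delta>)"
    using h by (metis embedding_map_in_subtopology subtopology_topspace)
  ultimately have "embedding_map K (Sigma_cube \<Delta>) h"
    using h by (auto simp: Sigma_cube_def embedding_map_in_subtopology image_subset_iff)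
  then show ?thesis
    using assms by (auto simp: Corson_compact_def)
qed

lemma Eberlein_compactI:
  fixes \<Gamma> :: "'i set"
  assumes "compact_space K" "Hausdorff_space K" "embedding_map K (c0_cube \<Gamma>) f"
  shows "Eberlein_compact K"
proof -
  have f: "embedding_map K (unit_cube \<Gamma>) f"
    and fin: "\<And>x \<epsilon>. x \<in> topspace K \<Longrightarrow> \<epsilon> > 0 \<Longrightarrow> finite {\<gamma> \<in> \<Gamma>. f x \<gamma> > \<epsilon>}"
    using assms(3) by (auto simp: c0_cube_def embedding_map_in_subtopology image_subset_iff)
  obtain \<Delta> :: "('a \<Rightarrow> real) set" and h r where
    h: "embedding_map K (unit_cube \<Delta>) h" and r: "inj_on r \<Delta>" "r ` \<Delta> \<subseteq> \<Gamma>"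
    and hf: "\<And>x d. x \<in> topspace K \<Longrightarrow> d \<in> \<Delta> \<Longrightarrow> h x d = f x (r d)"
    using cube_embedding_reindex[OF assms(1) f] by blast
  have "finite {d \<in> \<Delta>. h x d > \<epsilon>}" if x: "x \<in> topspace K" and \<epsilon>: "\<epsilon> > 0" for x \<epsilon>
  proof (rule finite_imageD)
    show "finite (r ` {d \<in> \<Delta>. h x d > \<epsilon>})"
      by (rule finite_subset[OF _ fin[OF x \<epsilon>]]) (use r hf[OF x] in auto)
    show "inj_on r {d \<in> \<Delta>. h x d > \<epsilon>}" using r(1) by (rule inj_on_subset) auto
  qed
  moreover have "h ` topspace K \<subseteq> topspace (unit_cube \<Delta>)"
    using h by (metis embedding_map_in_subtopology subtopology_topspace)
  ultimately have "embedding_map K (c0_cube \<Delta>) h"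
    using h by (auto simp: c0_cube_def embedding_map_in_subtopology image_subset_iff)
  then show ?thesis
    using assms by (auto simp: Eberlein_compact_def)
qed

lemma compact_metrizable_lepoll_real:
  assumes "compact_space X" "metrizable_space X"
  shows "topspace X \<lesssim> (UNIV :: real set)"
proof -
  obtain M d where M: "Metric_space M d" and X: "X = Metric_space.mtopology M d"
    using assms(2) by (auto simp: metrizable_space_def)
  interpret Metric_space M d by (rule M)
  have "mtotally_bounded M"
    using assms(1) X by (metis compactin_imp_mtotally_bounded compact_space_def topspace_mtopology)
  then have "\<exists>F. finite F \<and> F \<subseteq> M \<and> M \<subseteq> (\<Union>x\<in>F. mball x (inverse (Suc n)))" for n
    by (simp add: mtotally_bounded_def del: of_nat_Suc)
  then obtain F where F: "\<And>n. finite (F n)" "\<And>n. F n \<subseteq> M"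
      "\<And>n. M \<subseteq> (\<Union>x\<in>F n. mball x (inverse (Suc n)))"
    by metis
  define D where "D = (\<Union>n. F n)"
  have D: "countable D" "D \<subseteq> M"
    using F by (auto simp: D_def countable_finite)
  define H where "H = (\<lambda>x. {m. \<exists>n k. k \<in> D \<and> m = prod_encode (n, to_nat_on D k) \<and> d k x < inverse (Suc n)})"
  have H: "prod_encode (n, to_nat_on D k) \<in> H x \<longleftrightarrow> d k x < inverse (Suc n)" if "k \<in> D" for n k x
    using that D(1) by (auto simp: H_def)
  have "inj_on H M"
  proof (rule inj_onI)
    fix x y assume x: "x \<in> M" and y: "y \<in> M" and eq: "H x = H y"
    have "d x y < 2 * inverse (Suc n)" for n
    proof -
      obtain k where k: "k \<in> F n" "d k x < inverse (Suc n)"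
        using F(3)[of n] x by (auto simp: in_mball)
      then have "k \<in> D" by (auto simp: D_def)
      then have "d k y < inverse (Suc n)"
        using H[of k n x] H[of k n y] k(2) eq by simp
      moreover have "d x y \<le> d k x + d k y"
        using triangle[of x k y] x y \<open>k \<in> D\<close> D(2) by (auto simp: commute)
      ultimately show ?thesis using k(2) by linarith
    qed
    note bd = this
    have "d x y = 0"
    proof (rule ccontr)
      assume "d x y \<noteq> 0"
      then have "d x y / 2 > 0" using nonneg[of x y] by linarith
      then obtain n where "inverse (Suc n) < d x y / 2"
        using reals_Archimedean by blast
      then show False using bd[of n] by linarith
    qed
    then show "x = y" using x y by simp
  qed
  then have "M \<lesssim> (UNIV :: nat set set)"
    by (auto simp: lepoll_def)
  then show ?thesis
    using X nat_sets_eqpoll_reals by (metis eqpoll_imp_lepoll lepoll_trans topspace_mtopology)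
qed

lemma transport_compact_metrizable:
  fixes X :: "'b topology"
  assumes "compact_space X" "metrizable_space X"
  obtains Y :: "real topology" and g
  where "compact_space Y" "metrizable_space Y" "homeomorphic_map X Y g" "g a = 0"
proof -
  obtain g0 :: "'b \<Rightarrow> real" where g0: "inj_on g0 (topspace X)"
    using compact_metrizable_lepoll_real[OF assms] by (auto simp: lepoll_def)
  define g where "g = (\<lambda>x. g0 x - g0 a)"
  define i where "i = inv_into (topspace X) g"
  define Y where "Y = pullback_topology (g ` topspace X) i X"
  have inj: "inj_on g (topspace X)"
    using g0 by (auto simp: inj_on_def g_def)
  have ig: "\<And>x. x \<in> topspace X \<Longrightarrow> i (g x) = x"
    using inj by (simp add: i_def)
  have tY: "topspace Y = g ` topspace X"
    using ig by (auto simp: Y_def topspace_pullback_topology)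
  have "continuous_map X Y g"
    unfolding Y_def
  proof (rule continuous_map_pullback')
    show "continuous_map X X (i \<circ> g)"
      by (rule continuous_map_eq[OF continuous_map_id]) (simp add: ig)
    show "topspace X \<subseteq> g -` g ` topspace X" by auto
  qed
  moreover have "continuous_map Y X i"
    unfolding Y_def by (metis comp_id continuous_map_id continuous_map_pullback id_comp)
  ultimately have "homeomorphic_maps X Y g i"
    using ig tY by (auto simp: homeomorphic_maps_def)
  then have hom: "homeomorphic_map X Y g"
    using homeomorphic_map_maps by blast
  then have "X homeomorphic_space Y"
    using homeomorphic_space by blast
  then have "compact_space Y" "metrizable_space Y"
    using assms homeomorphic_compact_space homeomorphic_metrizable_space by blast+
  then show thesis
    using that[of Y g] hom by (simp add: g_def)
qed

lemma NY_compactI: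
  fixes K :: "'a topology" and \<Gamma> :: "'i set" and X :: "'i \<Rightarrow> 'b topology"
  assumes K: "compact_space K" "Hausdorff_space K"
    and X: "\<And>\<gamma>. \<gamma> \<in> \<Gamma> \<Longrightarrow> compact_space (X \<gamma>)" "\<And>\<gamma>. \<gamma> \<in> \<Gamma> \<Longrightarrow> metrizable_space (X \<gamma>)"
    and a: "a \<in> topspace (product_topology X \<Gamma>)"
    and emb: "embedding_map K (sigma_product \<Gamma> X a) f"
  shows "NY_compact K"
proof -
  have "\<exists>(Y :: real topology) g. compact_space Y \<and> metrizable_space Y \<and>
      homeomorphic_map (X \<gamma>) Y g \<and> g (a \<gamma>) = 0" if "\<gamma> \<in> \<Gamma>" for \<gamma>
    using transport_compact_metrizable[OF X(1)[OF that] X(2)[OF that], of "a \<gamma>"] by metis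
  then obtain Y :: "'i \<Rightarrow> real topology" and g where
    Y: "\<And>\<gamma>. \<gamma> \<in> \<Gamma> \<Longrightarrow> compact_space (Y \<gamma>)" "\<And>\<gamma>. \<gamma> \<in> \<Gamma> \<Longrightarrow> metrizable_space (Y \<gamma>)"
    and g: "\<And>\<gamma>. \<gamma> \<in> \<Gamma> \<Longrightarrow> homeomorphic_map (X \<gamma>) (Y \<gamma>) (g \<gamma>)" "\<And>\<gamma>. \<gamma> \<in> \<Gamma> \<Longrightarrow> g \<gamma> (a \<gamma>) = 0"
    by metis
  have f: "embedding_map K (product_topology X \<Gamma>) f"
    and fin: "\<And>x. x \<in> topspace K \<Longrightarrow> finite {\<gamma> \<in> \<Gamma>. f x \<gamma> \<noteq> a \<gamma>}"
    using emb by (auto simp: sigma_product_def embedding_map_in_subtopology image_subset_iff)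
  have cf: "continuous_map K (product_topology X \<Gamma>) f" and injf: "inj_on f (topspace K)"
    using f by (auto simp: embedding_map_def homeomorphic_eq_everything_map continuous_map_in_subtopology)
  have fX: "f x \<gamma> \<in> topspace (X \<gamma>)" if "x \<in> topspace K" "\<gamma> \<in> \<Gamma>" for x \<gamma>
    using continuous_map_image_subset_topspace[OF cf] that by (auto simp: PiE_iff)
  define c where "c \<equiv> \<lambda>\<gamma> x. if x \<in> topspace K then g \<gamma> (f x \<gamma>) else 0"
  define \<Delta> where "\<Delta> = c ` \<Gamma>"
  define r where "r = inv_into \<Gamma> c"
  define Z where "Z = (\<lambda>d. Y (r d))"
  define h where "h = (\<lambda>x. restrict (\<lambda>d. g (r d) (f x (r d))) \<Delta>)"
  define b where "b = restrict (\<lambda>d::'a \<Rightarrow> real. 0::real) \<Delta>"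
  have r: "r d \<in> \<Gamma>" "c (r d) = d" if "d \<in> \<Delta>" for d
    using that by (auto simp: r_def \<Delta>_def inv_into_into f_inv_into_f)
  have injr: "inj_on r \<Delta>"
    by (metis inj_on_inverseI r(2))
  have injg: "\<And>\<gamma>. \<gamma> \<in> \<Gamma> \<Longrightarrow> inj_on (g \<gamma>) (topspace (X \<gamma>))"
    using g(1) homeomorphic_imp_injective_map by blast
  have b: "b \<in> topspace (product_topology Z \<Delta>)"
  proof -
    have "0 \<in> topspace (Z d)" if "d \<in> \<Delta>" for d
    proof -
      have "a (r d) \<in> topspace (X (r d))" using a r(1)[OF that] by (auto simp: PiE_iff)
      then have "g (r d) (a (r d)) \<in> topspace (Y (r d))"
        using homeomorphic_imp_surjective_map[OF g(1)[OF r(1)[OF that]]] by blast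
      then show ?thesis using g(2)[OF r(1)[OF that]] by (simp add: Z_def)
    qed
    then show ?thesis by (auto simp: b_def)
  qed
  have ch: "continuous_map K (product_topology Z \<Delta>) h"
    unfolding continuous_map_componentwise
  proof (intro conjI ballI)
    show "h ` topspace K \<subseteq> extensional \<Delta>" by (auto simp: h_def)
    fix d assume d: "d \<in> \<Delta>"
    have "continuous_map K (X (r d)) (\<lambda>x. f x (r d))"
      using cf r(1)[OF d] by (simp add: continuous_map_componentwise)
    from continuous_map_compose[OF this homeomorphic_imp_continuous_map[OF g(1)[OF r(1)[OF d]]]]
    show "continuous_map K (Z d) (\<lambda>x. h x d)"
      using d by (simp add: h_def Z_def o_def)
  qed
  have "inj_on h (topspace K)"
  proof (rule inj_onI)
    fix x y assume x: "x \<in> topspace K" and y: "y \<in> topspace K" and eq: "h x = h y"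
    have "f x \<gamma> = f y \<gamma>" if \<gamma>: "\<gamma> \<in> \<Gamma>" for \<gamma>
    proof -
      have d: "c \<gamma> \<in> \<Delta>" using \<gamma> by (simp add: \<Delta>_def)
      then have "c (r (c \<gamma>)) x = c (r (c \<gamma>)) y"
        using fun_cong[OF eq, of "c \<gamma>"] x y by (simp add: h_def c_def)
      then have "c \<gamma> x = c \<gamma> y" by (simp add: r(2)[OF d])
      then have "g \<gamma> (f x \<gamma>) = g \<gamma> (f y \<gamma>)" using x y by (simp add: c_def)
      then show ?thesis using inj_onD[OF injg[OF \<gamma>]] fX \<gamma> x y by blast
    qed
    moreover have "f x \<in> extensional \<Gamma>" "f y \<in> extensional \<Gamma>"
      using cf x y by (auto simp: continuous_map_componentwise)
    ultimately have "f x = f y" by (metis extensionalityI)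
    then show "x = y" using injf x y by (meson inj_onD)
  qed
  moreover have "Hausdorff_space (product_topology Z \<Delta>)"
    unfolding Hausdorff_space_product_topology
    using Y(2) r(1) metrizable_imp_Hausdorff_space by (auto simp: Z_def)
  ultimately have h: "embedding_map K (product_topology Z \<Delta>) h"
    using ch K by (blast intro: continuous_imp_embedding_map)
  have "finite {d \<in> \<Delta>. h x d \<noteq> b d}" if x: "x \<in> topspace K" for x
  proof (rule finite_imageD)
    show "finite (r ` {d \<in> \<Delta>. h x d \<noteq> b d})"
      by (rule finite_subset[OF _ fin[OF x]]) (use r(1) g(2) in \<open>auto simp: h_def b_def\<close>)
    show "inj_on r {d \<in> \<Delta>. h x d \<noteq> b d}" using injr by (rule inj_on_subset) auto
  qed
  moreover have "h ` topspace K \<subseteq> topspace (product_topology Z \<Delta>)"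
    using continuous_map_image_subset_topspace[OF ch] by blast
  ultimately have "embedding_map K (sigma_product \<Delta> Z b) h"
    using h unfolding sigma_product_def embedding_map_in_subtopology by blast
  moreover have "\<forall>d\<in>\<Delta>. compact_space (Z d) \<and> metrizable_space (Z d)"
    using Y r(1) by (auto simp: Z_def)
  ultimately show ?thesis
    using K b unfolding NY_compact_def by blast
qed

end

theory Submission
  imports Defs "HOL-Library.Countable_Set_Type"
begin

text \<open>
  Everything is expressed through families of functions separating the points of \<open>K\<close>: for a Corson
  compactum every point has countably many nonzero coordinates, and \<open>K\<close> is NY compact as soon as the
  coordinates can be grouped into countable blocks such that every point is nonzero on only finitely
  many blocks, because each block \<open>B\<close> then contributes the compact metrizable factor \<open>[0,1]\<^sup>B\<close>.

  Let \<open>K\<close> be NY compact. For a finite set \<open>F\<close> of coordinates, the points whose support is contained in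
  \<open>F\<close> form a compact metrizable space, and the points whose support contains \<open>F\<close> form an open set.
  A Baire category argument on the cardinality of the support gives M-scatteredness
  (\<open>sigma_embedding.M_scattered\<close>). Restricting, for each \<open>F\<close>, countably many members of an open cover
  to the points with support containing \<open>F\<close> gives a point-countable refinement
  (\<open>sigma_embedding.hereditarily_metalindelof\<close>). Replacing each factor by countably many real
  functions damped by \<open>1/(n+1)\<close> gives an embedding into \<open>c\<^sub>0\<close> (\<open>sigma_embedding.Eberlein\<close>), and an
  Eberlein compactum is trivially Corson.

  Let \<open>K\<close> be hereditarily metalindelof and M-scattered. Peeling off second countable pieces exhausts
  \<open>K\<close>; covering properties of the open sets that arise keep the accompanying open neighbourhoods of the
  pieces point-countable (\<open>separating_pairs_Union\<close>). Countably many functions per piece make \<open>K\<close> Corson.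

  The core of the proof is that an M-scattered Corson compactum \<open>K\<close> is NY compact. M-scatteredness
  assigns to every nonempty closed set \<open>H\<close> a second countable part \<open>core H\<close>, the last one to survive when
  second countable pieces are peeled off, such that passing to a nonempty closed subset that misses the
  core decreases a rank (\<open>M_scattered_cores\<close>).
  Apply this to the boxes of \<open>K\<close> cut out by finitely many rational conditions, and close sets of
  coordinates under adding all coordinates that are nonzero somewhere on the core of such a box; only
  countably many are added for each box. If \<open>A\<close> is closed in this sense, then cutting a point \<open>z\<close> down
  to \<open>A\<close> gives a point \<open>y\<close> of \<open>K\<close>, and by minimality of the rank \<open>y\<close> lies in the core of a box with
  conditions on finitely many coordinates in \<open>A\<close>. Hence the part of the support of \<open>z\<close> in \<open>A\<close> is already
  forced by these finitely many coordinates. So the support of \<open>z\<close> cannot keep growing along an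
  increasing sequence of closed sets, and an induction on cardinality produces the blocks
  (\<open>countable_blocks\<close>).
\<close>

section \<open>Second countable subspaces and separating functions\<close>

lemma compact_metrizable_imp_second_countable:
  assumes "compact_space X" "metrizable_space X"
  shows "second_countable X"
proof -
  obtain M d where M: "Metric_space M d" and X: "X = Metric_space.mtopology M d"
    using assms(2) by (auto simp: metrizable_space_def)
  interpret Metric_space M d by (rule M)
  have "mtotally_bounded M"
    using assms(1) X by (metis compactin_imp_mtotally_bounded compact_space_def topspace_mtopology)
  then have "\<exists>F. finite F \<and> F \<subseteq> M \<and> M \<subseteq> (\<Union>x\<in>F. mball x (inverse (Suc n)))" for n
    by (simp add: mtotally_bounded_def del: of_nat_Suc)
  then obtain F where F: "\<And>n. finite (F n)" "\<And>n. F n \<subseteq> M"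
      "\<And>n. M \<subseteq> (\<Union>x\<in>F n. mball x (inverse (Suc n)))"
    by metis
  define \<B> where "\<B> = (\<Union>n. (\<lambda>x. mball x (inverse (Suc n))) ` F n)"
  have "\<exists>V\<in>\<B>. x \<in> V \<and> V \<subseteq> U" if U: "openin X U" "x \<in> U" for U x
  proof -
    have x: "x \<in> M" using U X openin_subset topspace_mtopology by blast
    obtain r where r: "r > 0" "mball x r \<subseteq> U"
      using U X openin_mtopology by auto
    obtain n where n: "inverse (Suc n) < r / 2"
      using reals_Archimedean r(1) half_gt_zero by blast
    obtain k where k: "k \<in> F n" "x \<in> mball k (inverse (Suc n))"
      using F(3)[of n] x by blast
    have "mball k (inverse (Suc n)) \<subseteq> mball x r"
    proof
      fix y assume y: "y \<in> mball k (inverse (Suc n))"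
      then have "d x y \<le> d x k + d k y" using triangle x k by (auto simp: in_mball)
      then show "y \<in> mball x r"
        using y k n x by (auto simp: in_mball commute)
    qed
    then show ?thesis using k r(2) unfolding \<B>_def by blast
  qed
  moreover have "countable \<B>"
    using F(1) by (auto simp: \<B>_def countable_finite)
  moreover have "\<forall>V\<in>\<B>. openin X V"
    by (auto simp: \<B>_def X)
  ultimately show ?thesis unfolding second_countable_def by metis
qed

lemma second_countable_subspace_mono:
  assumes "second_countable (subtopology X S)" "T \<subseteq> S"
  shows "second_countable (subtopology X T)"
  using second_countable_subtopology[OF assms(1), of T] assms(2)
  by (simp add: subtopology_subtopology Int_absorb1)

lemma second_countable_subspace_base:
  assumes "second_countable (subtopology X P)" "P \<subseteq> topspace X"
  obtains \<B> where "countable \<B>" "\<And>x V. x \<in> P \<Longrightarrow> openin X V \<Longrightarrow> x \<in> V \<Longrightarrow> \<exists>B\<in>\<B>. x \<in> B \<and> B \<subseteq> V"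
proof -
  obtain \<B> where \<B>: "countable \<B>"
    "\<And>U x. openin (subtopology X P) U \<Longrightarrow> x \<in> U \<Longrightarrow> \<exists>V\<in>\<B>. x \<in> V \<and> V \<subseteq> U"
    using assms(1) unfolding second_countable_def by metis
  show thesis
  proof (rule that[OF \<B>(1)])
    fix x V assume x: "x \<in> P" "openin X V" "x \<in> V"
    then have "openin (subtopology X P) (V \<inter> P)" "x \<in> V \<inter> P"
      by (simp_all add: openin_subtopology_Int)
    from \<B>(2)[OF this] show "\<exists>B\<in>\<B>. x \<in> B \<and> B \<subseteq> V" by blast
  qed
qed

text \<open>
  A point of \<open>P\<close> can be separated from the other points of \<open>P\<close> and from the complement of \<open>U\<close> by
  functions supported in \<open>U\<close>. Whether some function is above \<open>1/2\<close> on one set and below \<open>1/2\<close> on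
  another depends only on a pair of sets of a base of \<open>P\<close>, so one function per pair is enough.
\<close>

lemma countable_separating_functions:
  assumes K: "compact_space K" "Hausdorff_space K" and U: "openin K U"
    and P: "P \<subseteq> U" "second_countable (subtopology K P)"
  obtains \<Phi> :: "('a \<Rightarrow> real) set" where "countable \<Phi>"
    "\<And>g. g \<in> \<Phi> \<Longrightarrow> continuous_map K (top_of_set {0..1}) g"
    "\<And>g x. g \<in> \<Phi> \<Longrightarrow> x \<in> topspace K - U \<Longrightarrow> g x = 0"
    "\<And>p q. p \<in> P \<Longrightarrow> q \<in> topspace K \<Longrightarrow> q \<noteq> p \<Longrightarrow> q \<in> P \<or> q \<notin> U \<Longrightarrow> \<exists>g\<in>\<Phi>. g p \<noteq> g q"
proof -
  have creg: "completely_regular_space K"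
    using K compact_Hausdorff_or_regular_imp_normal_space normal_imp_completely_regular_space
    by blast
  have PK: "P \<subseteq> topspace K" using P U openin_subset by blast
  obtain \<B> where \<B>: "countable \<B>"
    "\<And>x V. x \<in> P \<Longrightarrow> openin K V \<Longrightarrow> x \<in> V \<Longrightarrow> \<exists>B\<in>\<B>. x \<in> B \<and> B \<subseteq> V"
    using second_countable_subspace_base[OF P(2) PK] by blast
  (* The empty second set serves the points q outside U, where g vanishes anyway. *)
  define Q where "Q = (\<lambda>B B' g. continuous_map K (top_of_set {0..1::real}) g \<and>
    (\<forall>x\<in>topspace K - U. g x = 0) \<and> (\<forall>x\<in>B. g x > 1/2) \<and> (\<forall>x\<in>B'. g x < 1/2))"
  define \<Phi> where "\<Phi> = (\<lambda>(B,B'). SOME g. Q B B' g) ` {(B,B') \<in> \<B> \<times> insert {} \<B>. \<exists>g. Q B B' g}"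
  have \<Phi>Q: "\<exists>B B'. Q B B' g" if g: "g \<in> \<Phi>" for g
  proof -
    obtain B B' where B: "\<exists>g. Q B B' g" "g = (SOME g. Q B B' g)"
      using g unfolding \<Phi>_def by auto
    show ?thesis using someI_ex[OF B(1)] unfolding B(2) by blast
  qed
  show thesis
  proof (rule that)
    show "countable \<Phi>"
      unfolding \<Phi>_def by (rule countable_image, rule countable_subset[of _ "\<B> \<times> insert {} \<B>"])
        (use \<B>(1) in auto)
    show "continuous_map K (top_of_set {0..1}) g" if "g \<in> \<Phi>" for g
      using \<Phi>Q[OF that] by (auto simp: Q_def)
    show "g x = 0" if "g \<in> \<Phi>" "x \<in> topspace K - U" for g x
      using \<Phi>Q[OF that(1)] that(2) by (auto simp: Q_def)
  next
    fix p q assume p: "p \<in> P" and q: "q \<in> topspace K" "q \<noteq> p" "q \<in> P \<or> q \<notin> U"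
    have "closedin K (insert q (topspace K - U))"
      using U q K(2) by (metis closedin_Hausdorff_singleton closedin_Un closedin_diff closedin_topspace insert_is_Un)
    moreover have "p \<in> topspace K - insert q (topspace K - U)"
      using p PK P(1) q by auto
    ultimately obtain f where f: "continuous_map K (top_of_set {0..1::real}) f" "f p = 0"
      "f ` insert q (topspace K - U) \<subseteq> {1}"
      using creg unfolding completely_regular_space_def by metis
    define g where "g = (\<lambda>x. 1 - f x)"
    have cg: "continuous_map K euclideanreal g"
      using f(1) unfolding g_def by (intro continuous_intros) (auto simp: continuous_map_in_subtopology)
    then have g: "continuous_map K (top_of_set {0..1}) g" "g p = 1" "g q = 0" "\<forall>x\<in>topspace K - U. g x = 0"
      using f by (auto simp: continuous_map_in_subtopology g_def image_subset_iff)
    have "openin K {x \<in> topspace K. g x \<in> {1/2<..}}" "openin K {x \<in> topspace K. g x \<in> {..<1/2}}"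
      by (rule openin_continuous_map_preimage[OF cg]; simp)+
    note op = this
    obtain B where B: "B \<in> \<B>" "p \<in> B" "\<forall>x\<in>B. g x > 1/2"
      using \<B>(2)[OF p op(1)] p PK g(2) by auto
    obtain B' where B': "B' \<in> insert {} \<B>" "q \<in> P \<Longrightarrow> q \<in> B'" "\<forall>x\<in>B'. g x < 1/2"
    proof (cases "q \<in> P")
      case True
      then obtain B' where "B' \<in> \<B>" "q \<in> B'" "\<forall>x\<in>B'. g x < 1/2"
        using \<B>(2)[OF True op(2)] q(1) g(3) by auto
      then show thesis using that by auto
    qed (use that[of "{}"] in auto)
    define h where "h = (SOME g. Q B B' g)"
    have "Q B B' g" using g B B' by (auto simp: Q_def)
    then have h: "Q B B' h" unfolding h_def by (rule someI[of "Q B B'"])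
    have "h \<in> \<Phi>"
      unfolding \<Phi>_def h_def using B(1) B'(1) h by (intro image_eqI[of _ _ "(B,B')"]) auto
    moreover have "h p > 1/2" "h q < 1/2"
      using h B(2) B'(2) q by (auto simp: Q_def)
    ultimately show "\<exists>g\<in>\<Phi>. g p \<noteq> g q" by (intro bexI[of _ h]) auto
  qed
qed

section \<open>From point-countable covers to Corson compacta\<close>

text \<open>
  A pair \<open>(U,P)\<close> stands for a second countable piece \<open>P\<close> with an open neighbourhood \<open>U\<close>. The last
  clause is what functions supported in \<open>U\<close> that separate the points of \<open>P\<close> need in order to
  distinguish \<open>x\<close> from \<open>y\<close>, and it is weak enough to survive the gluing in \<open>separating_pairs_Union\<close>.
\<close>

definition separating_pairs :: "'a topology \<Rightarrow> 'a set \<Rightarrow> ('a set \<times> 'a set) set \<Rightarrow> bool" where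
  "separating_pairs X G \<S> \<longleftrightarrow>
     (\<forall>U P. (U,P) \<in> \<S> \<longrightarrow> openin X U \<and> U \<subseteq> G \<and> P \<subseteq> U \<and> second_countable (subtopology X P)) \<and>
     (\<forall>z\<in>G. countable {s \<in> \<S>. z \<in> fst s}) \<and>
     (\<forall>x\<in>G. \<exists>U P. (U,P) \<in> \<S> \<and> x \<in> P) \<and>
     (\<forall>x\<in>G. \<forall>y\<in>G. x \<noteq> y \<longrightarrow>
        (\<exists>U P. (U,P) \<in> \<S> \<and> (x \<in> P \<and> y \<in> P \<or> x \<in> P \<and> y \<notin> U \<or> y \<in> P \<and> x \<notin> U)))"

lemma separating_pairsD:
  assumes "separating_pairs X G \<S>"
  shows "(U,P) \<in> \<S> \<Longrightarrow> openin X U" "(U,P) \<in> \<S> \<Longrightarrow> U \<subseteq> G" "(U,P) \<in> \<S> \<Longrightarrow> P \<subseteq> U"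
    "(U,P) \<in> \<S> \<Longrightarrow> second_countable (subtopology X P)"
    "z \<in> G \<Longrightarrow> countable {s \<in> \<S>. z \<in> fst s}"
    "z \<in> G \<Longrightarrow> \<exists>U P. (U,P) \<in> \<S> \<and> z \<in> P"
    "x \<in> G \<Longrightarrow> y \<in> G \<Longrightarrow> x \<noteq> y \<Longrightarrow>
      \<exists>U P. (U,P) \<in> \<S> \<and> (x \<in> P \<and> y \<in> P \<or> x \<in> P \<and> y \<notin> U \<or> y \<in> P \<and> x \<notin> U)"
  using assms unfolding separating_pairs_def by simp_all

lemma separating_pairs_add_piece:
  assumes S: "separating_pairs X G \<S>" and V: "openin X (G \<union> V)"
    and P: "second_countable (subtopology X (V - G))"
  shows "separating_pairs X (G \<union> V) (insert (G \<union> V, V - G) \<S>)"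
proof -
  have "countable {s \<in> insert (G \<union> V, V - G) \<S>. z \<in> fst s}" if z: "z \<in> G \<union> V" for z
  proof -
    have "countable {s \<in> \<S>. z \<in> fst s}"
    proof (cases "z \<in> G")
      case True
      then show ?thesis by (rule separating_pairsD(5)[OF S])
    next
      case False
      then have "{s \<in> \<S>. z \<in> fst s} = {}"
        using separating_pairsD(2)[OF S] by force
      then show ?thesis by (simp only: countable_empty)
    qed
    then have "countable (insert (G \<union> V, V - G) {s \<in> \<S>. z \<in> fst s})" by simp
    then show ?thesis by (rule countable_subset[rotated]) auto
  qed
  moreover have "\<exists>U P. (U,P) \<in> insert (G \<union> V, V - G) \<S> \<and>
      (x \<in> P \<and> y \<in> P \<or> x \<in> P \<and> y \<notin> U \<or> y \<in> P \<and> x \<notin> U)"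
    if x: "x \<in> G \<union> V" and y: "y \<in> G \<union> V" and "x \<noteq> y" for x y
  proof -
    have sub: "U \<subseteq> G" if "(U,Q) \<in> \<S>" for U Q
      by (rule separating_pairsD(2)[OF S that])
    have cov: "\<exists>U P. (U,P) \<in> \<S> \<and> z \<in> P" if "z \<in> G" for z
      by (rule separating_pairsD(6)[OF S that])
    consider "x \<in> G" "y \<in> G" | "x \<in> G" "y \<notin> G" | "x \<notin> G" "y \<in> G" | "x \<notin> G" "y \<notin> G" by blast
    then show ?thesis
    proof cases
      case 1
      show ?thesis using separating_pairsD(7)[OF S 1 \<open>x \<noteq> y\<close>] by blast
    next
      case 2
      obtain U P where "(U,P) \<in> \<S>" "x \<in> P" using cov[OF 2(1)] by blast
      moreover from sub[OF this(1)] have "y \<notin> U" using 2(2) by blast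
      ultimately show ?thesis by blast
    next
      case 3
      obtain U P where "(U,P) \<in> \<S>" "y \<in> P" using cov[OF 3(2)] by blast
      moreover from sub[OF this(1)] have "x \<notin> U" using 3(1) by blast
      ultimately show ?thesis by blast
    next
      case 4
      then have "x \<in> V - G" "y \<in> V - G" using x y by blast+
      then show ?thesis by blast
    qed
  qed
  moreover have "\<exists>U P. (U,P) \<in> insert (G \<union> V, V - G) \<S> \<and> x \<in> P" if "x \<in> G \<union> V" for x
    using separating_pairsD(6)[OF S, of x] that by (cases "x \<in> G") blast+
  moreover have "openin X U \<and> U \<subseteq> G \<union> V \<and> Q \<subseteq> U \<and> second_countable (subtopology X Q)"
    if "(U,Q) \<in> insert (G \<union> V, V - G) \<S>" for U Q
    using separating_pairsD(1-4)[OF S, of U Q] that V P by auto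
  ultimately show ?thesis
    unfolding separating_pairs_def by simp
qed

text \<open>
  The pairs of the members of \<open>\<G>\<close> cannot simply be collected, since a point may lie in uncountably many
  members. Instead every pair is cut down to the members \<open>V\<close> of a point-countable refinement. Points
  \<open>x \<in> V\<close> and \<open>y \<notin> V\<close> are then separated by the restriction to \<open>V\<close> of any pair whose piece contains
  \<open>x\<close>; this is where the covering clause of the definition is used.
\<close>

lemma separating_pairs_Union:
  assumes meta: "metalindelof_space (subtopology X (\<Union>\<G>))"
    and \<G>: "\<And>G. G \<in> \<G> \<Longrightarrow> openin X G \<and> (\<exists>\<S>. separating_pairs X G \<S>)"
  shows "\<exists>\<S>. separating_pairs X (\<Union>\<G>) \<S>"
proof -
  have op: "openin X (\<Union>\<G>)" using \<G> by (intro openin_Union) simp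
  then have op': "openin (subtopology X (\<Union>\<G>)) V \<longleftrightarrow> openin X V \<and> V \<subseteq> \<Union>\<G>" for V
    by (rule openin_open_subtopology)
  have top: "topspace (subtopology X (\<Union>\<G>)) = \<Union>\<G>"
    using openin_subset[OF op] by (rule topspace_subtopology_subset)
  have "\<forall>G\<in>\<G>. openin (subtopology X (\<Union>\<G>)) G"
    using \<G> unfolding op' by (simp add: Union_upper)
  from meta[unfolded metalindelof_space_def top, THEN spec, THEN mp, OF conjI[OF this refl]]
  obtain \<V> where *: "(\<forall>V\<in>\<V>. openin (subtopology X (\<Union>\<G>)) V) \<and> \<Union>\<V> = \<Union>\<G> \<and>
    (\<forall>V\<in>\<V>. \<exists>U\<in>\<G>. V \<subseteq> U) \<and> (\<forall>x\<in>\<Union>\<G>. countable {V \<in> \<V>. x \<in> V})" ..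
  have \<V>: "\<And>V. V \<in> \<V> \<Longrightarrow> openin X V" "\<Union>\<V> = \<Union>\<G>" "\<And>V. V \<in> \<V> \<Longrightarrow> \<exists>G\<in>\<G>. V \<subseteq> G"
    using * by (simp_all add: op')
  have \<V>4: "\<And>x. x \<in> \<Union>\<G> \<Longrightarrow> countable {V \<in> \<V>. x \<in> V}"
    using *[THEN conjunct2, THEN conjunct2, THEN conjunct2] by (rule bspec)
  have "\<forall>V\<in>\<V>. \<exists>Z. V \<subseteq> fst Z \<and> separating_pairs X (fst Z) (snd Z)"
  proof
    fix V assume "V \<in> \<V>"
    then obtain G where "G \<in> \<G>" "V \<subseteq> G" using \<V>(3) by blast
    then obtain \<S> where "separating_pairs X G \<S>" using \<G> by blast
    then show "\<exists>Z. V \<subseteq> fst Z \<and> separating_pairs X (fst Z) (snd Z)"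
      using \<open>V \<subseteq> G\<close> by (intro exI[of _ "(G,\<S>)"]) simp
  qed
  from bchoice[OF this] obtain Z where Z: "\<forall>V\<in>\<V>. V \<subseteq> fst (Z V) \<and> separating_pairs X (fst (Z V)) (snd (Z V))" ..
  define G where "G = (\<lambda>V. fst (Z V))"
  define \<S> where "\<S> = (\<lambda>V. snd (Z V))"
  have GS: "\<And>V. V \<in> \<V> \<Longrightarrow> V \<subseteq> G V" "\<And>V. V \<in> \<V> \<Longrightarrow> separating_pairs X (G V) (\<S> V)"
    using Z by (simp_all add: G_def \<S>_def)
  note GS' = separating_pairsD[OF GS(2)]
  define \<T> where "\<T> = (\<Union>V\<in>\<V>. (\<lambda>(U,P). (U \<inter> V, P \<inter> V)) ` \<S> V)"
  have \<T>I: "(U \<inter> V, P \<inter> V) \<in> \<T>" if "V \<in> \<V>" "(U,P) \<in> \<S> V" for U V P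
    using that by (force simp: \<T>_def)
  have "openin X U \<and> U \<subseteq> \<Union>\<G> \<and> P \<subseteq> U \<and> second_countable (subtopology X P)" if "(U,P) \<in> \<T>" for U P
  proof -
    obtain V U' P' where V: "V \<in> \<V>" "(U',P') \<in> \<S> V" "U = U' \<inter> V" "P = P' \<inter> V"
      using \<open>(U,P) \<in> \<T>\<close> by (auto simp: \<T>_def)
    have "openin X U'" "P' \<subseteq> U'" "second_countable (subtopology X P')"
      by (rule GS'(1,3,4)[OF V(1,2)])+
    then show ?thesis
      using V \<V>(1,2) second_countable_subspace_mono[of X P' P] by auto
  qed
  moreover have "countable {s \<in> \<T>. z \<in> fst s}" if z: "z \<in> \<Union>\<G>" for z
  proof (rule countable_subset)
    show "{s \<in> \<T>. z \<in> fst s} \<subseteq>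
        (\<Union>V\<in>{V \<in> \<V>. z \<in> V}. (\<lambda>(U,P). (U \<inter> V, P \<inter> V)) ` {s \<in> \<S> V. z \<in> fst s})"
      by (force simp: \<T>_def)
    have "countable {s \<in> \<S> V. z \<in> fst s}" if "V \<in> \<V>" "z \<in> V" for V
      using GS'(5)[OF that(1)] GS(1)[OF that(1)] that(2) by blast
    then show "countable (\<Union>V\<in>{V \<in> \<V>. z \<in> V}. (\<lambda>(U,P). (U \<inter> V, P \<inter> V)) ` {s \<in> \<S> V. z \<in> fst s})"
      using \<V>4[OF z] by (intro countable_UN countable_image) auto
  qed
  moreover have "\<exists>U P. (U,P) \<in> \<T> \<and> x \<in> P" if x: "x \<in> \<Union>\<G>" for x
  proof -
    obtain V where V: "V \<in> \<V>" "x \<in> V" using x \<V>(2) by blast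
    then obtain U P where "(U,P) \<in> \<S> V" "x \<in> P" using GS'(6)[OF V(1)] GS(1)[OF V(1)] by blast
    then show ?thesis using \<T>I[OF V(1)] V(2) by blast
  qed
  moreover have "\<exists>U P. (U,P) \<in> \<T> \<and> (x \<in> P \<and> y \<in> P \<or> x \<in> P \<and> y \<notin> U \<or> y \<in> P \<and> x \<notin> U)"
    if x: "x \<in> \<Union>\<G>" and y: "y \<in> \<Union>\<G>" and ne: "x \<noteq> y" for x y
  proof -
    obtain V where V: "V \<in> \<V>" "x \<in> V" using x \<V>(2) by blast
    then have xG: "x \<in> G V" using GS(1) by blast
    show ?thesis
    proof (cases "y \<in> V")
      case True
      then have "y \<in> G V" using V GS(1) by blast
      then obtain U P where "(U,P) \<in> \<S> V" "x \<in> P \<and> y \<in> P \<or> x \<in> P \<and> y \<notin> U \<or> y \<in> P \<and> x \<notin> U"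
        using GS'(7)[OF V(1) xG _ ne] by blast
      then show ?thesis using \<T>I[OF V(1)] V(2) True by blast
    next
      case False
      obtain U P where "(U,P) \<in> \<S> V" "x \<in> P" using GS'(6)[OF V(1) xG] by blast
      then show ?thesis using \<T>I[OF V(1)] V(2) False by blast
    qed
  qed
  ultimately have "separating_pairs X (\<Union>\<G>) \<T>"
    unfolding separating_pairs_def by simp
  then show ?thesis by blast
qed

text \<open>
  By gluing there is a largest open set with separating pairs, and by M-scatteredness a proper open
  subset can always be enlarged by one more second countable piece.
\<close>

lemma separating_pairs_topspace:
  assumes X: "hereditarily metalindelof_space X" "M_scattered X"
  shows "\<exists>\<S>. separating_pairs X (topspace X) \<S>"
proof -
  define \<G> where "\<G> = {G. openin X G \<and> (\<exists>\<S>. separating_pairs X G \<S>)}"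
  have op: "openin X (\<Union>\<G>)" by (auto simp: \<G>_def)
  have "metalindelof_space (subtopology X (\<Union>\<G>))"
    using X(1) by (simp add: hereditarily)
  then have "\<exists>\<S>. separating_pairs X (\<Union>\<G>) \<S>"
    by (rule separating_pairs_Union) (simp add: \<G>_def)
  then obtain \<S> where \<S>: "separating_pairs X (\<Union>\<G>) \<S>" ..
  have "\<Union>\<G> = topspace X"
  proof (rule ccontr)
    assume "\<Union>\<G> \<noteq> topspace X"
    then have "topspace X - \<Union>\<G> \<noteq> {}" using op openin_subset by blast
    then obtain W where W: "openin (subtopology X (topspace X - \<Union>\<G>)) W" "W \<noteq> {}"
      "second_countable (subtopology X W)"
      using X(2) unfolding M_scattered_def by (meson Diff_subset)
    obtain V where V: "openin X V" "W = V \<inter> (topspace X - \<Union>\<G>)"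
      using W(1) by (auto simp: openin_subtopology)
    then have WV: "W = V - \<Union>\<G>" using openin_subset by blast
    then have "separating_pairs X (\<Union>\<G> \<union> V) (insert (\<Union>\<G> \<union> V, V - \<Union>\<G>) \<S>)"
      using separating_pairs_add_piece[OF \<S>] op V(1) W(3) by blast
    then have "\<Union>\<G> \<union> V \<in> \<G>" unfolding \<G>_def using op V(1) by blast
    then show False using W(2) WV by blast
  qed
  then show ?thesis using \<S> by metis
qed

lemma unit_cube_embedding_of_functions:
  fixes e :: "'i \<Rightarrow> 'a \<Rightarrow> real"
  assumes K: "compact_space K"
    and e: "\<And>i. i \<in> I \<Longrightarrow> continuous_map K (top_of_set {0..1}) (e i)"
    and sep: "\<And>x y. x \<in> topspace K \<Longrightarrow> y \<in> topspace K \<Longrightarrow> x \<noteq> y \<Longrightarrow> \<exists>i\<in>I. e i x \<noteq> e i y"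
  shows "embedding_map K (unit_cube I) (\<lambda>x. restrict (\<lambda>i. e i x) I)"
proof (rule continuous_imp_embedding_map[OF _ K])
  show "continuous_map K (unit_cube I) (\<lambda>x. restrict (\<lambda>i. e i x) I)"
    unfolding continuous_map_componentwise using e by auto
  show "inj_on (\<lambda>x. restrict (\<lambda>i. e i x) I) (topspace K)"
    using sep unfolding inj_on_def by (metis restrict_apply')
qed (simp add: Hausdorff_space_product_topology Hausdorff_space_subtopology)

lemma Corson_compact_functionsI:
  fixes e :: "'i \<Rightarrow> 'a \<Rightarrow> real"
  assumes K: "compact_space K" "Hausdorff_space K"
    and e: "\<And>i. i \<in> I \<Longrightarrow> continuous_map K (top_of_set {0..1}) (e i)"
    and cnt: "\<And>x. x \<in> topspace K \<Longrightarrow> countable {i \<in> I. e i x \<noteq> 0}"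
    and sep: "\<And>x y. x \<in> topspace K \<Longrightarrow> y \<in> topspace K \<Longrightarrow> x \<noteq> y \<Longrightarrow> \<exists>i\<in>I. e i x \<noteq> e i y"
  shows "Corson_compact K"
proof -
  define f where "f = (\<lambda>x. restrict (\<lambda>i. e i x) I)"
  have emb: "embedding_map K (unit_cube I) f"
    unfolding f_def by (rule unit_cube_embedding_of_functions[OF K(1) e sep])
  then have "f ` topspace K \<subseteq> topspace (unit_cube I)"
    by (metis embedding_map_in_subtopology subtopology_topspace)
  moreover have "{i \<in> I. f x i \<noteq> 0} = {i \<in> I. e i x \<noteq> 0}" for x by (auto simp: f_def)
  ultimately have "embedding_map K (Sigma_cube I) f"
    using emb cnt unfolding Sigma_cube_def embedding_map_in_subtopology
    by (simp add: image_subset_iff del: topspace_product_topology)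
  then show ?thesis by (rule Corson_compactI[OF K])
qed

text \<open>
  A point lies in only countably many of the neighbourhoods \<open>U\<close>, and the functions chosen for
  \<open>(U,P)\<close> vanish outside \<open>U\<close>, so point-countability passes from the neighbourhoods to the functions.
\<close>

lemma hereditarily_metalindelof_imp_Corson:
  assumes K: "compact_space K" "Hausdorff_space K"
    and X: "hereditarily metalindelof_space K" "M_scattered K"
  shows "Corson_compact K"
proof -
  obtain \<S> where "separating_pairs K (topspace K) \<S>"
    using separating_pairs_topspace[OF X] by blast
  note \<S> = separating_pairsD[OF this]
  define good where "good = (\<lambda>(U,P) (\<Phi> :: ('a \<Rightarrow> real) set). countable \<Phi> \<and>
    (\<forall>g\<in>\<Phi>. continuous_map K (top_of_set {0..1}) g \<and> (\<forall>x\<in>topspace K - U. g x = 0)) \<and>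
    (\<forall>p\<in>P. \<forall>q\<in>topspace K. q \<noteq> p \<longrightarrow> q \<in> P \<or> q \<notin> U \<longrightarrow> (\<exists>g\<in>\<Phi>. g p \<noteq> g q)))"
  have "\<exists>\<Phi>. good s \<Phi>" if s: "s \<in> \<S>" for s
  proof -
    obtain U P where UP: "s = (U,P)" by fastforce
    then have "openin K U" "P \<subseteq> U" "second_countable (subtopology K P)" using \<S>(1,3,4) s by simp_all
    from countable_separating_functions[OF K this] obtain \<Phi> :: "('a \<Rightarrow> real) set" where "countable \<Phi>"
      "\<And>g. g \<in> \<Phi> \<Longrightarrow> continuous_map K (top_of_set {0..1}) g"
      "\<And>g x. g \<in> \<Phi> \<Longrightarrow> x \<in> topspace K - U \<Longrightarrow> g x = 0"
      "\<And>p q. p \<in> P \<Longrightarrow> q \<in> topspace K \<Longrightarrow> q \<noteq> p \<Longrightarrow> q \<in> P \<or> q \<notin> U \<Longrightarrow> \<exists>g\<in>\<Phi>. g p \<noteq> g q"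
      by blast
    then show ?thesis unfolding good_def UP by (intro exI[of _ \<Phi>]) auto
  qed
  then obtain \<Phi> where \<Phi>: "\<And>s. s \<in> \<S> \<Longrightarrow> good s (\<Phi> s)" by metis
  have \<Phi>': "countable (\<Phi> (U,P))" "g \<in> \<Phi> (U,P) \<Longrightarrow> continuous_map K (top_of_set {0..1}) g"
     "g \<in> \<Phi> (U,P) \<Longrightarrow> x \<in> topspace K - U \<Longrightarrow> g x = 0"
     "p \<in> P \<Longrightarrow> q \<in> topspace K \<Longrightarrow> q \<noteq> p \<Longrightarrow> q \<in> P \<or> q \<notin> U \<Longrightarrow> \<exists>g\<in>\<Phi> (U,P). g p \<noteq> g q"
    if "(U,P) \<in> \<S>" for U P g x p q
    using \<Phi>[OF that] unfolding good_def by auto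
  show ?thesis
  proof (rule Corson_compact_functionsI[OF K, where e = "\<lambda>g. g" and I = "\<Union>(\<Phi> ` \<S>)"])
    show "continuous_map K (top_of_set {0..1}) g" if "g \<in> \<Union>(\<Phi> ` \<S>)" for g
      using that \<Phi>'(2) by auto
  next
    fix x assume x: "x \<in> topspace K"
    have "{g \<in> \<Union>(\<Phi> ` \<S>). g x \<noteq> 0} \<subseteq> (\<Union>s\<in>{s \<in> \<S>. x \<in> fst s}. \<Phi> s)"
      using \<Phi>'(3) x by fastforce
    moreover have "countable (\<Union>s\<in>{s \<in> \<S>. x \<in> fst s}. \<Phi> s)"
      using \<S>(5)[OF x] \<Phi>'(1) by (intro countable_UN) auto
    ultimately show "countable {g \<in> \<Union>(\<Phi> ` \<S>). g x \<noteq> 0}" by (rule countable_subset)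
  next
    fix x y assume xy: "x \<in> topspace K" "y \<in> topspace K" "x \<noteq> y"
    then obtain U P where UP: "(U,P) \<in> \<S>" "x \<in> P \<and> y \<in> P \<or> x \<in> P \<and> y \<notin> U \<or> y \<in> P \<and> x \<notin> U"
      using \<S>(7)[OF xy] by blast
    then have "\<exists>g\<in>\<Phi> (U,P). g x \<noteq> g y"
      using \<Phi>'(4)[OF UP(1), of x y] \<Phi>'(4)[OF UP(1), of y x] xy by metis
    then show "\<exists>g\<in>\<Union>(\<Phi> ` \<S>). g x \<noteq> g y" using UP(1) by blast
  qed
qed

section \<open>Cores of closed sets in M-scattered compacta\<close>

text \<open>
  Second countable pieces \<open>s \<xi> - G \<xi>\<close> are peeled off along a well-order \<open>R\<close> until \<open>X\<close> is exhausted.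
  The stages are indexed by all sets of points: there are more of these than points, so the
  process must stop.
\<close>

lemma M_scattered_exhaustion:
  fixes X :: "'a topology"
  assumes "M_scattered X"
  obtains G s :: "'a set \<Rightarrow> 'a set" and R where "wf R" "trans R" "total R"
    "\<And>\<xi>. openin X (s \<xi>)" "\<And>\<xi>. G \<xi> = (\<Union>\<eta>\<in>{\<eta>. (\<eta>,\<xi>) \<in> R}. s \<eta>)"
    "\<And>\<xi>. G \<xi> \<subseteq> s \<xi>" "\<And>\<xi>. second_countable (subtopology X (s \<xi> - G \<xi>))"
    "\<exists>\<xi>. s \<xi> = topspace X"
proof -
  have "\<exists>V'. openin X V \<longrightarrow> openin X V' \<and> V \<subseteq> V' \<and> second_countable (subtopology X (V' - V)) \<and>
      (V \<noteq> topspace X \<longrightarrow> V' - V \<noteq> {})" for V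
  proof (cases "openin X V \<and> V \<noteq> topspace X")
    case True
    then have "topspace X - V \<noteq> {}" using openin_subset by blast
    then obtain W where W: "openin (subtopology X (topspace X - V)) W" "W \<noteq> {}"
      "second_countable (subtopology X W)"
      using assms unfolding M_scattered_def by (meson Diff_subset)
    obtain O' where O': "openin X O'" "W = O' \<inter> (topspace X - V)"
      using W(1) by (auto simp: openin_subtopology)
    then have "V \<union> O' - V = W" using openin_subset by blast
    then show ?thesis using True O'(1) W by (intro exI[of _ "V \<union> O'"]) auto
  next
    case False
    have "second_countable (subtopology X {})"
      unfolding second_countable_def by (intro exI[of _ "{}"]) auto
    then show ?thesis using False by (intro exI[of _ V]) auto
  qed
  then obtain n where n: "\<And>V. openin X V \<Longrightarrow> openin X (n V)" "\<And>V. openin X V \<Longrightarrow> V \<subseteq> n V"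
    "\<And>V. openin X V \<Longrightarrow> second_countable (subtopology X (n V - V))"
    "\<And>V. openin X V \<Longrightarrow> V \<noteq> topspace X \<Longrightarrow> n V - V \<noteq> {}"
    by metis
  obtain r :: "'a set rel" where r: "well_order_on UNIV r"
    using well_order_on by blast
  define R where "R = r - Id"
  have R: "wf R" "trans R" "total R"
    using r unfolding R_def well_order_on_def linear_order_on_def partial_order_on_def preorder_on_def
    by (auto simp: total_on_def intro: trans_diff_Id)
  define G where "G = wfrec R (\<lambda>f \<xi>. \<Union>\<eta>\<in>{\<eta>. (\<eta>,\<xi>) \<in> R}. n (f \<eta>))"
  have G: "G \<xi> = (\<Union>\<eta>\<in>{\<eta>. (\<eta>,\<xi>) \<in> R}. n (G \<eta>))" for \<xi>
    unfolding def_wfrec[OF G_def[THEN eq_reflection] R(1), of \<xi>] by (simp add: cut_apply)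
  have op: "openin X (G \<xi>)" for \<xi>
  proof (induction \<xi> rule: wf_induct[OF R(1)])
    case (1 \<xi>)
    then show ?case using n(1) by (subst G) (auto intro!: openin_Union)
  qed
  (* Otherwise choosing a point of every piece would inject the sets of points into the points. *)
  have "\<exists>\<xi>. G \<xi> = topspace X"
  proof (rule ccontr)
    assume "\<nexists>\<xi>. G \<xi> = topspace X"
    then have "\<exists>p. p \<in> n (G \<xi>) - G \<xi>" for \<xi> using n(4)[OF op] by blast
    then obtain p where p: "\<And>\<xi>. p \<xi> \<in> n (G \<xi>)" "\<And>\<xi>. p \<xi> \<notin> G \<xi>" by (metis DiffE)
    have "p \<xi> \<noteq> p \<eta>" if "(\<eta>,\<xi>) \<in> R" for \<xi> \<eta>
      using p(1)[of \<eta>] p(2)[of \<xi>] G[of \<xi>] that by auto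
    then have "inj p"
      using R(3) unfolding inj_def total_on_def by (metis UNIV_I)
    then have "surj (inv p)" by (rule inj_imp_surj_inv)
    then show False using Cantors_theorem[of UNIV] by (metis Pow_UNIV)
  qed
  then have "\<exists>\<xi>. n (G \<xi>) = topspace X"
    using n(1,2) op openin_subset by (metis subset_antisym)
  then show thesis
    by (rule that[of R "\<lambda>\<xi>. n (G \<xi>)" G, OF R n(1)[OF op] G n(2)[OF op] n(3)[OF op]])
qed

text \<open>
  By compactness, the first stage \<open>s \<xi>\<close> of the exhaustion that contains \<open>H\<close> is not reached in the
  limit: \<open>H\<close> is not contained in \<open>G \<xi>\<close>. The core \<open>H - G \<xi>\<close> is the last part of \<open>H\<close> to be peeled off,
  and a nonempty closed subset of \<open>H\<close> that misses it is contained in \<open>G \<xi>\<close>, hence in an earlier stage.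
\<close>

lemma M_scattered_cores:
  assumes K: "compact_space K" "M_scattered K"
  obtains core :: "'a set \<Rightarrow> 'a set" where
    "\<And>H. closedin K H \<Longrightarrow> H \<noteq> {} \<Longrightarrow> core H \<subseteq> H \<and> core H \<noteq> {} \<and> closedin K (core H) \<and>
       second_countable (subtopology K (core H))"
    "wf {(H',H). closedin K H' \<and> H' \<noteq> {} \<and> closedin K H \<and> H \<noteq> {} \<and> H' \<subseteq> H - core H}"
proof -
  obtain G s :: "'a set \<Rightarrow> 'a set" and R where R: "wf R" "trans R" "total R"
    and op: "\<And>\<xi>. openin K (s \<xi>)" and G: "\<And>\<xi>. G \<xi> = (\<Union>\<eta>\<in>{\<eta>. (\<eta>,\<xi>) \<in> R}. s \<eta>)"
    and Gs: "\<And>\<xi>. G \<xi> \<subseteq> s \<xi>" and sc: "\<And>\<xi>. second_countable (subtopology K (s \<xi> - G \<xi>))"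
    and top: "\<exists>\<xi>. s \<xi> = topspace K"
    by (rule M_scattered_exhaustion[OF K(2)], rule that; assumption)
  have mono: "s \<eta> \<subseteq> s \<xi>" if "(\<eta>,\<xi>) \<in> R" for \<eta> \<xi>
    using Gs[of \<xi>] G[of \<xi>] that by blast
  have tot: "s \<eta> \<subseteq> s \<xi> \<or> s \<xi> \<subseteq> s \<eta>" for \<eta> \<xi>
    using mono R(3) unfolding total_on_def by (metis UNIV_I order.refl)
  have reach: "\<exists>\<eta>. (\<eta>,\<xi>) \<in> R \<and> H \<subseteq> s \<eta>" if H: "closedin K H" "H \<noteq> {}" "H \<subseteq> G \<xi>" for H \<xi>
  proof -
    define \<C> where "\<C> = s ` {\<eta>. (\<eta>,\<xi>) \<in> R}"
    have "compactin K H" using H(1) K(1) closedin_compact_space by blast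
    then obtain \<F> where \<F>: "finite \<F>" "\<F> \<subseteq> \<C>" "H \<subseteq> \<Union>\<F>"
      using compactinD[of K H \<C>] op H(3) G[of \<xi>] by (auto simp: \<C>_def)
    have "\<F> \<noteq> {}" using \<F>(3) H(2) by auto
    moreover have "subset.chain UNIV \<F>"
      unfolding subset.chain_def using \<F>(2) tot unfolding \<C>_def by blast
    ultimately have "\<Union>\<F> \<in> \<F>" using \<F>(1) Union_in_chain by blast
    then have "\<Union>\<F> \<in> \<C>" using \<F>(2) by (rule subsetD[rotated])
    then obtain \<eta> where "\<Union>\<F> = s \<eta>" "\<eta> \<in> {\<eta>. (\<eta>,\<xi>) \<in> R}"
      unfolding \<C>_def by (rule imageE)
    then show ?thesis using \<F>(3) by (intro exI[of _ \<eta>]) simp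
  qed
  have "\<exists>\<xi>. H \<subseteq> s \<xi> \<and> (\<forall>\<eta>. (\<eta>,\<xi>) \<in> R \<longrightarrow> \<not> H \<subseteq> s \<eta>)" if H: "closedin K H" for H
  proof -
    obtain \<xi>0 where "\<xi>0 \<in> {\<xi>. H \<subseteq> s \<xi>}" using top H closedin_subset by blast
    then obtain \<xi> where "\<xi> \<in> {\<xi>. H \<subseteq> s \<xi>}" "\<And>\<eta>. (\<eta>,\<xi>) \<in> R \<Longrightarrow> \<eta> \<notin> {\<xi>. H \<subseteq> s \<xi>}"
      using wfE_min[OF R(1)] by metis
    then show ?thesis by blast
  qed
  then obtain m where m: "\<And>H. closedin K H \<Longrightarrow> H \<subseteq> s (m H)"
    "\<And>H \<eta>. closedin K H \<Longrightarrow> (\<eta>, m H) \<in> R \<Longrightarrow> \<not> H \<subseteq> s \<eta>"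
    by metis
  define core where "core = (\<lambda>H. H - G (m H))"
  have opG: "openin K (G \<xi>)" for \<xi>
    unfolding G[of \<xi>] using op by blast
  show thesis
  proof (rule that[of core])
    fix H assume H: "closedin K H" "H \<noteq> {}"
    have "core H \<noteq> {}"
      using reach[OF H] m(2)[OF H(1)] unfolding core_def by blast
    moreover have "closedin K (core H)"
      unfolding core_def using H(1) opG by (rule closedin_diff)
    moreover have "second_countable (subtopology K (core H))"
      using sc[of "m H"] by (rule second_countable_subspace_mono) (use m(1)[OF H(1)] in \<open>auto simp: core_def\<close>)
    ultimately show "core H \<subseteq> H \<and> core H \<noteq> {} \<and> closedin K (core H) \<and>
       second_countable (subtopology K (core H))"
      by (auto simp: core_def)
  next
    have mR: "(m H', m H) \<in> R" if H: "closedin K H'" "H' \<noteq> {}" "closedin K H" "H' \<subseteq> H - core H" for H' H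
    proof -
      have "H' \<subseteq> G (m H)" using H(4) by (auto simp: core_def)
      then obtain \<eta> where \<eta>: "(\<eta>, m H) \<in> R" "H' \<subseteq> s \<eta>" using reach[OF H(1,2)] by blast
      then have "(\<eta>, m H') \<notin> R" using m(2)[OF H(1)] by blast
      then have "\<eta> = m H' \<or> (m H', \<eta>) \<in> R" using R(3) by (auto simp: total_on_def)
      then show ?thesis using \<eta>(1) R(2) by (metis transD)
    qed
    show "wf {(H',H). closedin K H' \<and> H' \<noteq> {} \<and> closedin K H \<and> H \<noteq> {} \<and> H' \<subseteq> H - core H}"
      by (rule wf_subset[OF wf_inv_image[OF R(1), of m]]) (clarify, unfold in_inv_image, rule mR)
  qed
qed

section \<open>Blocks of coordinates\<close>

unbundle cardinal_syntax

text \<open>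
  Closure under a set-valued finitary operation, that is, the closed sets of an algebraic closure
  system; unions of chains of closed sets are closed.
\<close>

definition fin_closed :: "('i set \<Rightarrow> 'i set) \<Rightarrow> 'i set \<Rightarrow> bool" where
  "fin_closed \<phi> A \<longleftrightarrow> (\<forall>F. finite F \<and> F \<subseteq> A \<longrightarrow> \<phi> F \<subseteq> A)"

lemma fin_closed_hull: "fin_closed \<phi> (fin_closed \<phi> hull X)"
  by (rule hull_in) (fastforce simp: fin_closed_def)

lemma fin_closed_Union_chain:
  assumes "\<C> \<noteq> {}" "\<And>A B. A \<in> \<C> \<Longrightarrow> B \<in> \<C> \<Longrightarrow> A \<subseteq> B \<or> B \<subseteq> A"
    and "\<And>A. A \<in> \<C> \<Longrightarrow> fin_closed \<phi> A"
  shows "fin_closed \<phi> (\<Union>\<C>)"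
  unfolding fin_closed_def
proof (intro allI impI)
  fix F assume F: "finite F \<and> F \<subseteq> \<Union>\<C>"
  have "subset.chain UNIV \<C>"
    using assms(2) by (auto simp: subset.chain_def)
  then obtain A where "A \<in> \<C>" "F \<subseteq> A"
    using finite_subset_Union_chain[of F \<C>] F assms(1) by metis
  then show "\<phi> F \<subseteq> \<Union>\<C>"
    using assms(3) F unfolding fin_closed_def by blast
qed

lemma card_of_finite_subsets_ordLeq:
  assumes Z: "infinite Z" and Y: "|Y| \<le>o |Z|"
  shows "|{F. finite F \<and> F \<subseteq> Y}| \<le>o |Z|"
proof -
  define E where "E = rec_nat {{}} (\<lambda>_ \<E>. \<Union>y\<in>Y. insert y ` \<E>)"
  have E: "E 0 = {{}}" "\<And>n. E (Suc n) = (\<Union>y\<in>Y. insert y ` E n)"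
    by (simp_all add: E_def)
  have "F \<in> (\<Union>n. E n)" if "finite F" "F \<subseteq> Y" for F
    using that
  proof (induction F rule: finite_induct)
    case empty
    then show ?case using E(1) by blast
  next
    case (insert y F)
    then obtain n where "F \<in> E n" by auto
    then have "insert y F \<in> E (Suc n)" using insert E(2) by blast
    then show ?case by blast
  qed
  then have sub: "{F. finite F \<and> F \<subseteq> Y} \<subseteq> (\<Union>n. E n)" by blast
  have "|E n| \<le>o |Z|" for n
  proof (induction n)
    case 0
    have "countable (E 0)" using E(1) by simp
    then show ?case
      using Z countable_card_of_nat infinite_iff_card_of_nat ordLeq_transitive by blast
  next
    case (Suc n)
    show ?case unfolding E(2)
      by (rule card_of_UNION_ordLeq_infinite[OF Z Y])
        (use Suc card_of_image ordLeq_transitive in blast)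
  qed
  then have "|\<Union>n. E n| \<le>o |Z|"
    using Z infinite_iff_card_of_nat card_of_UNION_ordLeq_infinite[OF Z] by blast
  then show ?thesis
    using card_of_mono1[OF sub] ordLeq_transitive by blast
qed

text \<open>
  The hull is reached in \<open>\<omega>\<close> steps, each of which adds countably many elements for every finite subset
  of what is already there.
\<close>

lemma card_of_fin_closed_hull:
  assumes A: "uncountable A" "fin_closed \<phi> A" and X: "X \<subseteq> A" "|X| <o |A|"
    and cnt: "\<And>F. finite F \<Longrightarrow> F \<subseteq> A \<Longrightarrow> countable (\<phi> F)"
  shows "|fin_closed \<phi> hull X| <o |A|"
proof -
  (* Adding a copy of the natural numbers treats countable and uncountable X alike. *)
  define Z where "Z = X <+> (UNIV :: nat set)"
  have Z: "infinite Z" by (simp add: Z_def)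
  have "|UNIV :: nat set| <o |A|"
    using A(1) countable_card_of_nat[of A]
      not_ordLeq_iff_ordLess[OF card_of_Well_order card_of_Well_order, of A "UNIV :: nat set"] by simp
  then have ZA: "|Z| <o |A|"
    unfolding Z_def using X(2) A(1) countable_finite
    by (intro card_of_Plus_ordLess_infinite) auto
  define W where "W = rec_nat X (\<lambda>_ Y. Y \<union> (\<Union>F\<in>{F. finite F \<and> F \<subseteq> Y}. \<phi> F))"
  have W: "W 0 = X" "\<And>n. W (Suc n) = W n \<union> (\<Union>F\<in>{F. finite F \<and> F \<subseteq> W n}. \<phi> F)"
    by (simp_all add: W_def)
  have WA: "W n \<subseteq> A" for n
  proof (induction n)
    case (Suc n)
    then show ?case using A(2) unfolding W(2) fin_closed_def by blast
  qed (simp add: W X)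
  have WZ: "|W n| \<le>o |Z|" for n
  proof (induction n)
    case 0
    show ?case by (simp add: W Z_def card_of_Plus1)
  next
    case (Suc n)
    have "|\<Union>F\<in>{F. finite F \<and> F \<subseteq> W n}. \<phi> F| \<le>o |Z|"
    proof (rule card_of_UNION_ordLeq_infinite[OF Z card_of_finite_subsets_ordLeq[OF Z Suc]], clarify)
      fix F assume "finite F" "F \<subseteq> W n"
      then have "countable (\<phi> F)" using cnt WA by blast
      then show "|\<phi> F| \<le>o |Z|"
        using Z countable_card_of_nat infinite_iff_card_of_nat ordLeq_transitive by blast
    qed
    then show ?case
      unfolding W(2) using Suc Z card_of_Un_ordLeq_infinite_Field[of "|Z|"] Field_card_of[of Z] card_of_Card_order[of Z] by simp
  qed
  have "incseq W"
    by (intro incseq_SucI) (simp add: W)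
  then have "fin_closed \<phi> (\<Union>n. W n)"
    unfolding fin_closed_def
  proof (intro allI impI)
    fix F assume inc: "incseq W" and F: "finite F \<and> F \<subseteq> (\<Union>n. W n)"
    have "subset.chain UNIV (range W)"
      unfolding subset.chain_def using monoD[OF inc] nat_le_linear by blast
    then obtain n where "F \<subseteq> W n"
      using finite_subset_Union_chain[of F "range W"] F by (metis UNIV_I empty_is_image image_iff UNIV_not_empty)
    then have "\<phi> F \<subseteq> W (Suc n)" using F by (auto simp: W)
    then show "\<phi> F \<subseteq> (\<Union>n. W n)" by blast
  qed
  then have sub: "fin_closed \<phi> hull X \<subseteq> (\<Union>n. W n)"
    by (intro hull_minimal) (use W(1) in blast)
  have "|\<Union>n. W n| \<le>o |Z|"
    using WZ Z infinite_iff_card_of_nat card_of_UNION_ordLeq_infinite[OF Z] by blast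
  then show ?thesis
    using card_of_mono1[OF sub] ZA ordLeq_transitive ordLeq_ordLess_trans by blast
qed

text \<open>
  The first \<open>\<omega>\<close> elements of \<open>T\<close> form such a subset: they are the elements with finitely many
  predecessors in \<open>T\<close>.
\<close>

lemma infinite_subset_wellorder_no_max:
  assumes r: "Well_order r" and T: "infinite T" "T \<subseteq> Field r"
  obtains T' where "T' \<subseteq> T" "T' \<noteq> {}" "\<And>b. b \<in> T' \<Longrightarrow> \<exists>c\<in>T'. b \<in> underS r c"
proof -
  interpret R: wo_rel r using wo_rel.intro[OF r] .
  define T' where "T' = {b \<in> T. finite (T \<inter> underS r b)}"
  have min: "\<exists>c\<in>Y. Y \<inter> underS r c = {}" if Y: "Y \<subseteq> Field r" "Y \<noteq> {}" for Y
  proof -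
    have "R.minim Y \<in> Y" using Y by (rule R.minim_in)
    moreover have "Y \<inter> underS r (R.minim Y) = {}"
      using Y R.minim_least[of Y] R.ANTISYM unfolding underS_def antisym_def by blast
    ultimately show ?thesis by blast
  qed
  have "T' \<noteq> {}"
    using min[of T] T by (force simp: T'_def)
  moreover have "\<exists>c\<in>T'. b \<in> underS r c" if b: "b \<in> T'" for b
  proof -
    define Y where "Y = T - (T \<inter> underS r b) - {b}"
    have "infinite Y" using b T(1) by (auto simp: Y_def T'_def)
    then obtain c where c: "c \<in> Y" "Y \<inter> underS r c = {}"
      using min[of Y] T(2) by (metis Diff_subset Y_def dual_order.trans finite.emptyI)
    have "T \<inter> underS r c \<subseteq> insert b (T \<inter> underS r b)"
      using c(2) by (auto simp: Y_def)
    then have "finite (T \<inter> underS r c)"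
      using b by (auto simp: T'_def intro: finite_subset)
    then have "c \<in> T'" using c by (auto simp: T'_def Y_def)
    moreover have "b \<in> underS r c"
      using R.TOTALS c(1) b T(2) by (auto simp: Y_def T'_def underS_def)
    ultimately show ?thesis by blast
  qed
  ultimately show thesis using that[of T'] by (auto simp: T'_def)
qed

text \<open>
  The proof is by induction on the cardinality of a closed set \<open>A\<close> in place of \<open>\<Gamma>\<close>. An uncountable
  \<open>A\<close> is the union of an increasing well-ordered family of closed sets \<open>H a\<close> of smaller cardinality;
  the blocks of \<open>A\<close> are the blocks of the sets \<open>H a\<close>, cut down to the layer \<open>L a\<close> of those elements that
  first appear in \<open>H a\<close>. A set \<open>S\<close> meets finitely many blocks of each \<open>H a\<close>, so it suffices that \<open>S\<close>
  meets only finitely many layers. If not, consider the union \<open>A'\<close> of the sets \<open>H a\<close> over infinitely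
  many such \<open>a\<close> without a largest one. It is closed, so \<open>S \<inter> A'\<close> is captured by a finite subset \<open>F\<close> of
  \<open>A'\<close>. But \<open>F\<close> is contained in a single \<open>H b\<close>, hence so is \<open>S \<inter> A'\<close>, and \<open>S\<close> meets no later layer.
\<close>

lemma countable_blocks:
  fixes \<Gamma> :: "'i set"
  assumes \<Gamma>: "fin_closed \<phi> \<Gamma>"
    and cnt: "\<And>F. finite F \<Longrightarrow> F \<subseteq> \<Gamma> \<Longrightarrow> countable (\<phi> F)"
    and cap: "\<And>S A. S \<in> \<S> \<Longrightarrow> A \<subseteq> \<Gamma> \<Longrightarrow> fin_closed \<phi> A \<Longrightarrow> \<exists>F. finite F \<and> F \<subseteq> A \<and> S \<inter> A \<subseteq> \<phi> F"
  obtains \<B> where "\<Union>\<B> = \<Gamma>" "\<And>B. B \<in> \<B> \<Longrightarrow> countable B"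
    "\<And>S. S \<in> \<S> \<Longrightarrow> finite {B \<in> \<B>. B \<inter> S \<noteq> {}}"
proof -
  define P where "P = (\<lambda>A \<B>. \<Union>\<B> = A \<and> (\<forall>B\<in>\<B>. countable B) \<and> (\<forall>S\<in>\<S>. finite {B \<in> \<B>. B \<inter> S \<noteq> {}}))"
  have "\<exists>\<B>. P A \<B>" if "A \<subseteq> \<Gamma>" "fin_closed \<phi> A" for A
    using that
  proof (induction A rule: wf_induct[OF wf_inv_image[OF wf_ordLess, of "card_of"]])
    case (1 A)
    have IH: "\<exists>\<B>. P A' \<B>" if "|A'| <o |A|" "A' \<subseteq> \<Gamma>" "fin_closed \<phi> A'" for A'
      using 1(1) that by (auto simp: inv_image_def)
    show ?case
    proof (cases "countable A")
      case True
      then show ?thesis by (intro exI[of _ "{A}"]) (auto simp: P_def)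
    next
      case unc: False
      define r where "r = |A|"
      have infA: "infinite A" using unc countable_finite by blast
      have r: "Well_order r" "Field r = A" "Card_order r"
        using card_of_Well_order[of A] Field_card_of[of A] card_of_Card_order[of A]
        by (simp_all only: r_def)
      interpret R: wo_rel r using wo_rel.intro[OF r(1)] .
      define H where "H = (\<lambda>a. fin_closed \<phi> hull (under r a))"
      have clH: "fin_closed \<phi> (H a)" for a
        by (simp add: H_def fin_closed_hull)
      have uA: "under r a \<subseteq> A" for a
        using r(2) under_Field by fastforce
      then have HA: "H a \<subseteq> A" for a
        unfolding H_def using 1(3) by (simp add: hull_minimal)
      have monoH: "H a \<subseteq> H b" if "(a,b) \<in> r" for a b
        unfolding H_def by (rule hull_mono, rule under_incr[OF R.TRANS that])
      have cardH: "|H a| <o |A|" if "a \<in> A" for a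
        unfolding H_def
      proof (rule card_of_fin_closed_hull[OF unc 1(3) uA])
        have "under r a = underS r a \<union> {a}"
          using R.REFL that r(2) by (auto simp: under_def underS_def refl_on_def)
        moreover have "|underS r a| <o |A|"
          using card_of_underS[OF r(3)] that r(2) by (simp add: r_def)
        moreover have "|{a}| <o |A|"
          using finite_ordLess_infinite[OF card_of_Well_order card_of_Well_order, of "{a}" A] infA
          unfolding Field_card_of by blast
        ultimately show "|under r a| <o |A|"
          using card_of_Un_ordLess_infinite[OF infA] by metis
      qed (use cnt 1(2) in blast)
      have "\<forall>a\<in>A. \<exists>\<B>. P (H a) \<B>"
        by (intro ballI IH cardH clH order.trans[OF HA 1(2)])
      from bchoice[OF this] obtain \<B> where "\<forall>a\<in>A. P (H a) (\<B> a)" ..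
      then have \<B>: "\<And>a. a \<in> A \<Longrightarrow> \<Union>(\<B> a) = H a"
        "\<And>a B. a \<in> A \<Longrightarrow> B \<in> \<B> a \<Longrightarrow> countable B"
        "\<And>a S. a \<in> A \<Longrightarrow> S \<in> \<S> \<Longrightarrow> finite {B \<in> \<B> a. B \<inter> S \<noteq> {}}"
        by (simp_all add: P_def)
      define L where "L = (\<lambda>a. H a - (\<Union>b\<in>underS r a. H b))"
      define \<D> where "\<D> = (\<Union>a\<in>A. (\<lambda>B. B \<inter> L a) ` \<B> a)"
      have "A \<subseteq> (\<Union>a\<in>A. L a)"
      proof
        fix x assume x: "x \<in> A"
        define Y where "Y = {a \<in> A. x \<in> H a}"
        have "x \<in> H x"
          unfolding H_def using R.REFL x r(2) hull_subset[of "under r x"]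
          by (auto simp: under_def refl_on_def)
        then have Y: "Y \<subseteq> Field r" "Y \<noteq> {}" using x r(2) by (auto simp: Y_def)
        have "R.minim Y \<in> Y" using Y by (rule R.minim_in)
        moreover have "Y \<inter> underS r (R.minim Y) = {}"
          using Y R.minim_least[of Y] R.ANTISYM unfolding underS_def antisym_def by blast
        ultimately have "x \<in> L (R.minim Y)" "R.minim Y \<in> A"
          using r(2) by (auto simp: Y_def L_def underS_def Field_def)
        then show "x \<in> (\<Union>a\<in>A. L a)" by blast
      qed
      moreover have "L a \<subseteq> H a" for a by (auto simp: L_def)
      ultimately have cover: "\<Union>\<D> = A"
        using \<B>(1) HA unfolding \<D>_def by (fastforce simp: set_eq_iff subset_iff)
      have "finite {B \<in> \<D>. B \<inter> S \<noteq> {}}" if S: "S \<in> \<S>" for S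
      proof -
        define T where "T = {a \<in> A. S \<inter> L a \<noteq> {}}"
        have "finite T"
        proof (rule ccontr)
          assume "infinite T"
          then obtain T' where T': "T' \<subseteq> T" "T' \<noteq> {}" "\<And>b. b \<in> T' \<Longrightarrow> \<exists>c\<in>T'. b \<in> underS r c"
            using infinite_subset_wellorder_no_max[OF r(1), of T] r(2) by (auto simp: T_def)
          define A' where "A' = \<Union>(H ` T')"
          have tot: "H a \<subseteq> H b \<or> H b \<subseteq> H a" if "a \<in> T'" "b \<in> T'" for a b
          proof -
            have "a \<in> Field r" "b \<in> Field r" using that T'(1) r(2) by (auto simp: T_def)
            then show ?thesis using R.TOTALS monoH by blast
          qed
          then have cl: "fin_closed \<phi> A'"
            unfolding A'_def using T'(2) clH tot by (intro fin_closed_Union_chain) auto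
          then obtain F where F: "finite F" "F \<subseteq> A'" "S \<inter> A' \<subseteq> \<phi> F"
            using cap[OF S, of A'] HA 1(2) by (auto simp: A'_def)
          have "subset.chain UNIV (H ` T')"
            unfolding subset.chain_def using tot by blast
          then obtain b where b: "b \<in> T'" "F \<subseteq> H b"
            using finite_subset_Union_chain[of F "H ` T'"] F T'(2) unfolding A'_def
            by (metis (no_types, lifting) image_iff image_is_empty)
          then have "\<phi> F \<subseteq> H b" using F(1) clH[of b] unfolding fin_closed_def by blast
          then have sub: "S \<inter> A' \<subseteq> H b" using F(3) by blast
          obtain c where c: "c \<in> T'" "b \<in> underS r c" using T'(3) b(1) by blast
          then obtain x where "x \<in> S" "x \<in> L c" using T'(1) by (auto simp: T_def)
          then have "x \<in> S \<inter> A'" "x \<notin> H b" using c by (auto simp: L_def A'_def)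
          then show False using sub by blast
        qed
        then have "finite (\<Union>a\<in>T. (\<lambda>B. B \<inter> L a) ` {B \<in> \<B> a. B \<inter> S \<noteq> {}})"
          using \<B>(3)[OF _ S] by (simp add: T_def)
        moreover have "{B \<in> \<D>. B \<inter> S \<noteq> {}} \<subseteq> (\<Union>a\<in>T. (\<lambda>B. B \<inter> L a) ` {B \<in> \<B> a. B \<inter> S \<noteq> {}})"
          by (auto simp: \<D>_def T_def)
        ultimately show ?thesis by (rule rev_finite_subset)
      qed
      moreover have "\<forall>B\<in>\<D>. countable B"
        using \<B>(2) by (auto simp: \<D>_def)
      ultimately have "P A \<D>" using cover by (simp add: P_def)
      then show ?thesis by blast
    qed
  qed
  from this[OF order.refl \<Gamma>] obtain \<B> where "P \<Gamma> \<B>" ..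
  then show thesis using that[of \<B>] by (simp add: P_def)
qed

section \<open>M-scattered Corson compacta are NY compact\<close>

lemma NY_compact_functionsI:
  fixes e :: "'i \<Rightarrow> 'a \<Rightarrow> real" and \<B> :: "'i set set"
  assumes K: "compact_space K" "Hausdorff_space K"
    and e: "\<And>i. i \<in> \<Union>\<B> \<Longrightarrow> continuous_map K (top_of_set {0..1}) (e i)"
    and cnt: "\<And>B. B \<in> \<B> \<Longrightarrow> countable B"
    and fin: "\<And>x. x \<in> topspace K \<Longrightarrow> finite {B \<in> \<B>. \<exists>i\<in>B. e i x \<noteq> 0}"
    and sep: "\<And>x y. x \<in> topspace K \<Longrightarrow> y \<in> topspace K \<Longrightarrow> x \<noteq> y \<Longrightarrow> \<exists>i\<in>\<Union>\<B>. e i x \<noteq> e i y"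
  shows "NY_compact K"
proof -
  define a where "a = restrict (\<lambda>B. restrict (\<lambda>i. 0 :: real) B) \<B>"
  define f where "f = (\<lambda>x. restrict (\<lambda>B. restrict (\<lambda>i. e i x) B) \<B>)"
  let ?P = "product_topology unit_cube \<B>"
  have "continuous_map K (unit_cube B) (\<lambda>x. restrict (\<lambda>i. e i x) B)" if "B \<in> \<B>" for B
    unfolding continuous_map_componentwise using e that by auto
  then have f: "continuous_map K ?P f"
    unfolding continuous_map_componentwise[of K unit_cube] by (auto simp: f_def)
  have "inj_on f (topspace K)"
  proof (rule inj_onI, rule ccontr)
    fix x y assume xy: "x \<in> topspace K" "y \<in> topspace K" "f x = f y" "x \<noteq> y"
    then obtain B i where "B \<in> \<B>" "i \<in> B" "e i x \<noteq> e i y" using sep by blast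
    moreover have "f x B i = f y B i" using xy by simp
    ultimately show False by (simp add: f_def)
  qed
  moreover have "Hausdorff_space ?P"
    by (simp add: Hausdorff_space_product_topology Hausdorff_space_subtopology)
  ultimately have "embedding_map K ?P f"
    using f K(1) by (blast intro: continuous_imp_embedding_map)
  moreover have "finite {B \<in> \<B>. f x B \<noteq> a B}" if "x \<in> topspace K" for x
    using fin[OF that] by (rule rev_finite_subset) (auto simp: f_def a_def restrict_def)
  ultimately have emb: "embedding_map K (sigma_product \<B> unit_cube a) f"
    using continuous_map_image_subset_topspace[OF f]
    unfolding sigma_product_def embedding_map_in_subtopology
    by (simp add: image_subset_iff del: topspace_product_topology)
  show ?thesis
  proof (rule NY_compactI[OF K _ _ _ emb])
    show "compact_space (unit_cube B)" for B :: "'i set"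
      by (simp add: compact_space_product_topology compact_space_subtopology)
    show "metrizable_space (unit_cube B)" if "B \<in> \<B>" for B
      unfolding metrizable_space_product_topology
      using cnt[OF that] by (auto simp: metrizable_space_subtopology metrizable_space_euclidean intro: countable_subset[of _ B])
    show "a \<in> topspace ?P" by (auto simp: a_def)
  qed
qed

text \<open>
  The coordinates are grouped by \<open>countable_blocks\<close>, applied to the supports \<open>S x\<close> and to the operation
  \<open>\<phi>\<close> that collects the supports of all points in cores of rational boxes. Its capture property holds
  because the restriction of \<open>z\<close> to a closed set \<open>A\<close> of coordinates, extended by \<open>0\<close>, is a point \<open>y\<close> of
  \<open>K\<close> lying in the core of a box \<open>box D\<close> with coordinates in \<open>A\<close>.
\<close>

lemma Corson_M_scattered_imp_NY:
  assumes K: "compact_space K" "Hausdorff_space K" and C: "Corson_compact K" and M: "M_scattered K"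
  shows "NY_compact K"
proof -
  obtain \<Gamma> :: "('a \<Rightarrow> real) set" and f where f: "embedding_map K (Sigma_cube \<Gamma>) f"
    using C by (auto simp: Corson_compact_def)
  then have emb: "embedding_map K (unit_cube \<Gamma>) f"
    and cntf: "\<And>x. x \<in> topspace K \<Longrightarrow> countable {i \<in> \<Gamma>. f x i \<noteq> 0}"
    by (auto simp: Sigma_cube_def embedding_map_in_subtopology image_subset_iff)
  have cf: "continuous_map K (unit_cube \<Gamma>) f" and injf: "inj_on f (topspace K)"
    using emb by (auto simp: embedding_map_def homeomorphic_eq_everything_map continuous_map_in_subtopology)
  have ce: "continuous_map K (top_of_set {0..1}) (\<lambda>x. f x i)" if "i \<in> \<Gamma>" for i
    using cf that by (simp add: continuous_map_componentwise)
  have cr: "continuous_map K euclideanreal (\<lambda>x. f x i)" if "i \<in> \<Gamma>" for i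
    using ce[OF that] by (simp add: continuous_map_in_subtopology)
  have f01: "0 \<le> f x i" "f x i \<le> 1" if "i \<in> \<Gamma>" "x \<in> topspace K" for i x
    using ce[OF that(1)] that(2) by (auto simp: continuous_map_in_subtopology image_subset_iff Pi_iff)
  have ext: "f x \<in> extensional \<Gamma>" if "x \<in> topspace K" for x
    using cf that by (auto simp: continuous_map_componentwise)
  have sepf: "x = y" if "x \<in> topspace K" "y \<in> topspace K" "\<And>i. i \<in> \<Gamma> \<Longrightarrow> f x i = f y i" for x y
    using injf that ext by (metis extensionalityI inj_onD)
  define S where "S = (\<lambda>x. {i \<in> \<Gamma>. f x i \<noteq> 0})"
  define box where "box = (\<lambda>D. {x \<in> topspace K. \<forall>(i,p,q)\<in>D. real_of_rat p \<le> f x i \<and> f x i \<le> real_of_rat q})"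
  have clbox: "closedin K (box D)" if "D \<subseteq> \<Gamma> \<times> UNIV" for D
  proof -
    have "closedin K {x \<in> topspace K. f x i \<in> {real_of_rat p..real_of_rat q}}" if "i \<in> \<Gamma>" for i p q
      by (rule closedin_continuous_map_preimage[OF cr[OF that]]) simp
    then have cl: "closedin K {x \<in> topspace K. real_of_rat p \<le> f x i \<and> f x i \<le> real_of_rat q}" if "i \<in> \<Gamma>" for i p q
      using that by simp
    have "box D = topspace K \<inter> \<Inter>((\<lambda>(i,p,q). {x \<in> topspace K. real_of_rat p \<le> f x i \<and> f x i \<le> real_of_rat q}) ` D)"
      by (auto simp: box_def)
    moreover have "closedin K \<dots>"
    proof (cases "D = {}")
      case False
      then show ?thesis using cl \<open>D \<subseteq> _\<close> by (intro closedin_Int closedin_topspace closedin_Inter) auto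
    qed simp
    ultimately show ?thesis by simp
  qed
  have box_Un: "box (D \<union> D') = box D \<inter> box D'" for D D'
    unfolding box_def by (auto simp: ball_Un)
  obtain core where core: "\<And>H. closedin K H \<Longrightarrow> H \<noteq> {} \<Longrightarrow> core H \<subseteq> H \<and> core H \<noteq> {} \<and> closedin K (core H) \<and>
       second_countable (subtopology K (core H))"
    and wfc: "wf {(H',H). closedin K H' \<and> H' \<noteq> {} \<and> closedin K H \<and> H \<noteq> {} \<and> H' \<subseteq> H - core H}"
    using M_scattered_cores[OF K(1) M] by blast
  define \<phi> where "\<phi> = (\<lambda>F. \<Union>D\<in>{D. finite D \<and> D \<subseteq> F \<times> UNIV \<and> box D \<noteq> {}}. \<Union>x\<in>core (box D). S x)"
  have \<phi>I: "S x \<subseteq> \<phi> F" if "finite D" "D \<subseteq> F \<times> UNIV" "x \<in> core (box D)" "box D \<noteq> {}" for x D F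
    using that unfolding \<phi>_def by blast
  have cnt\<phi>: "countable (\<phi> F)" if F: "finite F" "F \<subseteq> \<Gamma>" for F
    unfolding \<phi>_def
  proof (rule countable_UN)
    have "countable {D. finite D \<and> D \<subseteq> F \<times> (UNIV :: (rat \<times> rat) set)}"
      using F(1) by (intro countable_Collect_finite_subset countable_SIGMA) (auto intro: countable_finite)
    then show "countable {D. finite D \<and> D \<subseteq> F \<times> UNIV \<and> box D \<noteq> {}}"
      by (rule countable_subset[rotated]) auto
    fix D assume "D \<in> {D. finite D \<and> D \<subseteq> F \<times> UNIV \<and> box D \<noteq> {}}"
    then have D: "D \<subseteq> \<Gamma> \<times> UNIV" "box D \<noteq> {}" using F(2) by auto
    define P where "P = core (box D)"
    have P: "P \<subseteq> topspace K" "second_countable (subtopology K P)"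
      using core[OF clbox[OF D(1)] D(2)] closedin_subset unfolding P_def by blast+
    then obtain Q where Q: "countable Q" "Q \<subseteq> P" "subtopology K P closure_of Q = P"
      using second_countable_imp_separable_space[OF P(2)]
      unfolding separable_space_def topspace_subtopology_subset[OF P(1)] by blast
    have "(\<Union>x\<in>P. S x) \<subseteq> (\<Union>x\<in>Q. S x)"
    proof clarify
      fix x i assume x: "x \<in> P" "i \<in> S x"
      then have i: "i \<in> \<Gamma>" by (simp add: S_def)
      have "openin K {y \<in> topspace K. f y i \<in> - {0}}"
        by (rule openin_continuous_map_preimage[OF cr[OF i]]) (simp add: open_Compl)
      then have W: "openin (subtopology K P) ({y \<in> topspace K. f y i \<in> - {0}} \<inter> P)"
        by (rule openin_subtopology_Int)
      have xW: "x \<in> {y \<in> topspace K. f y i \<in> - {0}} \<inter> P" using x P(1) by (auto simp: S_def)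
      have "x \<in> subtopology K P closure_of Q" using x Q(3) by simp
      then have "\<And>T. x \<in> T \<Longrightarrow> openin (subtopology K P) T \<Longrightarrow> \<exists>y. y \<in> Q \<and> y \<in> T"
        unfolding in_closure_of by simp
      from this[OF xW W] obtain y where "y \<in> Q \<and> y \<in> {y \<in> topspace K. f y i \<in> - {0}} \<inter> P" ..
      then show "i \<in> (\<Union>x\<in>Q. S x)" using i by (auto simp: S_def)
    qed
    moreover have "countable (\<Union>x\<in>Q. S x)"
      using Q(1,2) P(1) cntf unfolding S_def by (intro countable_UN) auto
    ultimately show "countable (\<Union>x\<in>core (box D). S x)"
      unfolding P_def by (rule countable_subset)
  qed
  (* By compactness of T: the points common to all rational boxes on A around w are exactly the
     points that agree with w on A. *)
  have pin: "\<exists>x\<in>T. \<forall>i\<in>A. f x i = f w i"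
    if A: "A \<subseteq> \<Gamma>" and T: "closedin K T" and w: "w \<in> topspace K"
      and meet: "\<And>D. finite D \<Longrightarrow> D \<subseteq> A \<times> UNIV \<Longrightarrow> w \<in> box D \<Longrightarrow> T \<inter> box D \<noteq> {}" for A T w
  proof -
    define \<D> where "\<D> = {D. finite D \<and> D \<subseteq> A \<times> UNIV \<and> w \<in> box D}"
    have "compactin K T" using T K(1) closedin_compact_space by blast
    moreover have "\<forall>C\<in>box ` \<D>. closedin K C" using clbox A unfolding \<D>_def by blast
    moreover have "T \<inter> \<Inter>\<F> \<noteq> {}" if \<F>: "finite \<F>" "\<F> \<subseteq> box ` \<D>" for \<F>
    proof -
      obtain \<E> where \<E>: "finite \<E>" "\<E> \<subseteq> \<D>" "\<F> = box ` \<E>"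
        using finite_subset_image[OF \<F>] by blast
      have "box (\<Union>\<E>) \<subseteq> \<Inter>\<F>" unfolding \<E>(3) by (auto simp: box_def)
      moreover have "T \<inter> box (\<Union>\<E>) \<noteq> {}"
      proof (rule meet)
        show "finite (\<Union>\<E>)" "\<Union>\<E> \<subseteq> A \<times> UNIV" using \<E>(1,2) unfolding \<D>_def by blast+
        show "w \<in> box (\<Union>\<E>)" using \<E>(2) w unfolding \<D>_def box_def by blast
      qed
      ultimately show ?thesis by blast
    qed
    ultimately have "T \<inter> \<Inter>(box ` \<D>) \<noteq> {}"
      unfolding compactin_fip by blast
    then obtain x where x: "x \<in> T" "\<And>D. D \<in> \<D> \<Longrightarrow> x \<in> box D" by blast
    have "f x i = f w i" if i: "i \<in> A" for i
    proof (rule ccontr)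
      have i\<Gamma>: "i \<in> \<Gamma>" using i A by blast
      assume "f x i \<noteq> f w i"
      then consider "f w i < f x i" | "f x i < f w i" by linarith
      then show False
      proof cases
        case 1
        then obtain q where q: "f w i < real_of_rat q" "real_of_rat q < f x i" using of_rat_dense by blast
        then have "{(i,0,q)} \<in> \<D>" using f01[OF i\<Gamma> w] w i by (auto simp: \<D>_def box_def)
        then show False using x(2) q(2) by (force simp: box_def)
      next
        case 2
        then obtain q where q: "f x i < real_of_rat q" "real_of_rat q < f w i" using of_rat_dense by blast
        then have "{(i,q,1)} \<in> \<D>" using f01[OF i\<Gamma> w] w i by (auto simp: \<D>_def box_def)
        then show False using x(2) q(1) by (force simp: box_def)
      qed
    qed
    then show ?thesis using x(1) by blast
  qed
  have cap: "\<exists>F. finite F \<and> F \<subseteq> A \<and> S z \<inter> A \<subseteq> \<phi> F"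
    if z: "z \<in> topspace K" and A: "A \<subseteq> \<Gamma>" "fin_closed \<phi> A" for z A
  proof -
    have core_A: "S x \<subseteq> A" if D: "finite D" "D \<subseteq> A \<times> UNIV" "box D \<noteq> {}" and x: "x \<in> core (box D)" for x D
    proof -
      have "finite (fst ` D)" "fst ` D \<subseteq> A" "D \<subseteq> fst ` D \<times> UNIV" using D by force+
      then show ?thesis using \<phi>I[OF D(1) _ x D(3)] A(2) unfolding fin_closed_def by blast
    qed
    (* Cores have supports in A, so the points supported in A meet every box on A that contains z. *)
    define KA where "KA = {x \<in> topspace K. S x \<subseteq> A}"
    have KA: "KA = \<Inter>(insert (topspace K) ((\<lambda>i. {x \<in> topspace K. f x i \<in> {0}}) ` (\<Gamma> - A)))"
      by (auto simp: KA_def S_def)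
    have cl0: "closedin K {x \<in> topspace K. f x i \<in> {0}}" if "i \<in> \<Gamma>" for i
      by (rule closedin_continuous_map_preimage[OF cr[OF that]]) simp
    have clKA: "closedin K KA"
      unfolding KA
    proof (rule closedin_Inter)
      fix C assume "C \<in> insert (topspace K) ((\<lambda>i. {x \<in> topspace K. f x i \<in> {0}}) ` (\<Gamma> - A))"
      then show "closedin K C" using cl0 by blast
    qed simp
    have "KA \<inter> box D \<noteq> {}" if D: "finite D" "D \<subseteq> A \<times> UNIV" "z \<in> box D" for D
    proof -
      have ne: "box D \<noteq> {}" using D(3) by blast
      have "closedin K (box D)" using D(2) A(1) by (intro clbox) blast
      note c = core[OF this ne]
      then obtain x where x: "x \<in> core (box D)" by blast
      then have "x \<in> KA" using core_A[OF D(1,2) ne x] c closedin_subset unfolding KA_def by blast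
      then show ?thesis using x c by blast
    qed
    then obtain y where y: "y \<in> KA" "\<And>i. i \<in> A \<Longrightarrow> f y i = f z i"
      using pin[OF A(1) clKA z] by blast
    have yK: "y \<in> topspace K" and Sy: "S y = S z \<inter> A"
      using y A(1) by (auto simp: KA_def S_def)
    (* Among the boxes on A around y take one of minimal rank. Its core cannot be separated from y
       by a smaller box on A, so it has a point x that agrees with y on A; as both are supported
       in A, this point is y. *)
    define \<H> where "\<H> = box ` {D. finite D \<and> D \<subseteq> A \<times> UNIV \<and> y \<in> box D}"
    have "box {} \<in> \<H>" unfolding \<H>_def using yK by (auto simp: box_def)
    then obtain H where H: "H \<in> \<H>"
      "\<And>H'. (H',H) \<in> {(H',H). closedin K H' \<and> H' \<noteq> {} \<and> closedin K H \<and> H \<noteq> {} \<and> H' \<subseteq> H - core H} \<Longrightarrow> H' \<notin> \<H>"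
      by (rule wfE_min[OF wfc]) (rule that, assumption, blast)
    obtain D where D: "finite D" "D \<subseteq> A \<times> UNIV" "y \<in> box D" "H = box D"
      using H(1) unfolding \<H>_def by blast
    have ne: "box D \<noteq> {}" using D(3) by blast
    have clD: "closedin K (box D)" using D(2) A(1) by (intro clbox) blast
    note c = core[OF clD ne]
    have "core (box D) \<inter> box D' \<noteq> {}" if D': "finite D'" "D' \<subseteq> A \<times> UNIV" "y \<in> box D'" for D'
    proof
      assume disj: "core (box D) \<inter> box D' = {}"
      have "box (D \<union> D') \<in> \<H>"
        unfolding \<H>_def using D D' by (intro imageI) (auto simp: box_Un)
      moreover have "closedin K (box (D \<union> D'))" using D(2) D'(2) A(1) by (intro clbox) blast
      moreover have "box (D \<union> D') \<noteq> {}" using D(3) D'(3) box_Un by blast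
      moreover have "box (D \<union> D') \<subseteq> box D - core (box D)" using disj box_Un by blast
      ultimately have "(box (D \<union> D'), H) \<in> {(H',H). closedin K H' \<and> H' \<noteq> {} \<and> closedin K H \<and> H \<noteq> {} \<and> H' \<subseteq> H - core H}"
        using clD ne unfolding D(4) by simp
      then show False using H(2) \<open>box (D \<union> D') \<in> \<H>\<close> by blast
    qed
    then obtain x where x: "x \<in> core (box D)" "\<And>i. i \<in> A \<Longrightarrow> f x i = f y i"
      using pin[OF A(1) _ yK, of "core (box D)"] c by blast
    have xK: "x \<in> topspace K" using x(1) c closedin_subset by blast
    have "x = y"
    proof (rule sepf[OF xK yK])
      fix i assume i: "i \<in> \<Gamma>"
      show "f x i = f y i"
      proof (cases "i \<in> A")
        case False
        have "S x \<subseteq> A" "S y \<subseteq> A" using core_A[OF D(1,2) ne x(1)] y(1) by (auto simp: KA_def)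
        then have "f x i = 0" "f y i = 0" using False i unfolding S_def by blast+
        then show ?thesis by simp
      qed (rule x(2))
    qed
    then have "S z \<inter> A \<subseteq> \<phi> (fst ` D)"
      using \<phi>I[OF D(1) _ x(1) ne, of "fst ` D"] Sy by force
    then show ?thesis using D(1,2) by (intro exI[of _ "fst ` D"]) auto
  qed
  have "fin_closed \<phi> \<Gamma>" unfolding fin_closed_def \<phi>_def S_def by blast
  then obtain \<B> where \<B>: "\<Union>\<B> = \<Gamma>" "\<And>B. B \<in> \<B> \<Longrightarrow> countable B"
    "\<And>T. T \<in> S ` topspace K \<Longrightarrow> finite {B \<in> \<B>. B \<inter> T \<noteq> {}}"
  proof (rule countable_blocks[of \<phi> \<Gamma> "S ` topspace K"])
    show "\<exists>F. finite F \<and> F \<subseteq> A \<and> T \<inter> A \<subseteq> \<phi> F"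
      if "T \<in> S ` topspace K" "A \<subseteq> \<Gamma>" "fin_closed \<phi> A" for T A
      using that cap by (elim imageE) simp
  qed (use cnt\<phi> in auto)
  show ?thesis
  proof (rule NY_compact_functionsI[OF K, where e = "\<lambda>i x. f x i" and \<B> = \<B>])
    fix x assume x: "x \<in> topspace K"
    have "{B \<in> \<B>. \<exists>i\<in>B. f x i \<noteq> 0} \<subseteq> {B \<in> \<B>. B \<inter> S x \<noteq> {}}"
      using \<B>(1) by (auto simp: S_def)
    then show "finite {B \<in> \<B>. \<exists>i\<in>B. f x i \<noteq> 0}"
      using \<B>(3)[of "S x"] x by (meson finite_subset imageI)
  next
    fix i assume "i \<in> \<Union>\<B>"
    then show "continuous_map K (top_of_set {0..1}) (\<lambda>x. f x i)" using ce \<B>(1) by simp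
  next
    fix x y assume "x \<in> topspace K" "y \<in> topspace K" "x \<noteq> y"
    then show "\<exists>i\<in>\<Union>\<B>. f x i \<noteq> f y i" unfolding \<B>(1) using sepf[of x y] by blast
  qed (rule \<B>(2))
qed

section \<open>Compact subsets of sigma-products\<close>

lemma Eberlein_imp_Corson:
  assumes "Eberlein_compact K"
  shows "Corson_compact K"
proof -
  obtain \<Gamma> :: "('a \<Rightarrow> real) set" and f where K: "compact_space K" "Hausdorff_space K"
    and f: "embedding_map K (c0_cube \<Gamma>) f"
    using assms by (auto simp: Eberlein_compact_def)
  have emb: "embedding_map K (unit_cube \<Gamma>) f"
    and fin: "\<And>x \<epsilon>. x \<in> topspace K \<Longrightarrow> \<epsilon> > 0 \<Longrightarrow> finite {i \<in> \<Gamma>. f x i > \<epsilon>}"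
    and sub: "f ` topspace K \<subseteq> topspace (unit_cube \<Gamma>)"
    using f by (auto simp: c0_cube_def embedding_map_in_subtopology image_subset_iff)
  have "countable {i \<in> \<Gamma>. f x i \<noteq> 0}" if x: "x \<in> topspace K" for x
  proof (rule countable_subset)
    have nonneg: "f x i \<ge> 0" if "i \<in> \<Gamma>" for i
      using sub x that by (auto simp: image_subset_iff PiE_iff)
    show "{i \<in> \<Gamma>. f x i \<noteq> 0} \<subseteq> (\<Union>n. {i \<in> \<Gamma>. f x i > inverse (real (Suc n))})"
    proof clarify
      fix i assume i: "i \<in> \<Gamma>" "f x i \<noteq> 0"
      then have "f x i > 0" using nonneg[of i] by simp
      then obtain n where "inverse (real (Suc n)) < f x i" using reals_Archimedean by blast
      then show "i \<in> (\<Union>n. {i \<in> \<Gamma>. f x i > inverse (real (Suc n))})" using i by blast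
    qed
    show "countable (\<Union>n. {i \<in> \<Gamma>. f x i > inverse (real (Suc n))})"
    proof (rule countable_UN)
      show "countable {i \<in> \<Gamma>. f x i > inverse (real (Suc n))}" for n
        by (rule countable_finite, rule fin[OF x]) simp
    qed simp
  qed
  then have "embedding_map K (Sigma_cube \<Gamma>) f"
    using emb sub unfolding Sigma_cube_def embedding_map_in_subtopology
    by (simp add: image_subset_iff del: topspace_product_topology)
  then show ?thesis by (rule Corson_compactI[OF K])
qed

lemma Eberlein_compact_functionsI:
  fixes e :: "'i \<Rightarrow> 'a \<Rightarrow> real"
  assumes K: "compact_space K" "Hausdorff_space K"
    and e: "\<And>i. i \<in> I \<Longrightarrow> continuous_map K (top_of_set {0..1}) (e i)"
    and fin: "\<And>x \<epsilon>. x \<in> topspace K \<Longrightarrow> \<epsilon> > 0 \<Longrightarrow> finite {i \<in> I. e i x > \<epsilon>}"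
    and sep: "\<And>x y. x \<in> topspace K \<Longrightarrow> y \<in> topspace K \<Longrightarrow> x \<noteq> y \<Longrightarrow> \<exists>i\<in>I. e i x \<noteq> e i y"
  shows "Eberlein_compact K"
proof -
  define f where "f = (\<lambda>x. restrict (\<lambda>i. e i x) I)"
  have emb: "embedding_map K (unit_cube I) f"
    unfolding f_def by (rule unit_cube_embedding_of_functions[OF K(1) e sep])
  then have sub: "f ` topspace K \<subseteq> topspace (unit_cube I)"
    by (metis embedding_map_in_subtopology subtopology_topspace)
  have "{i \<in> I. f x i > \<epsilon>} = {i \<in> I. e i x > \<epsilon>}" for x \<epsilon> by (auto simp: f_def)
  then have "embedding_map K (c0_cube I) f"
    using emb fin sub
    unfolding c0_cube_def embedding_map_in_subtopology
    by (simp add: image_subset_iff del: topspace_product_topology)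
  then show ?thesis by (rule Eberlein_compactI[OF K])
qed

text \<open>
  An embedding of \<open>K\<close> into a sigma-product, given by its coordinate functions: since \<open>K\<close> is compact,
  separating points is enough.
\<close>

locale sigma_embedding =
  fixes K :: "'a topology" and \<Gamma> :: "'i set" and X :: "'i \<Rightarrow> 'b topology" and a :: "'i \<Rightarrow> 'b"
    and f :: "'a \<Rightarrow> 'i \<Rightarrow> 'b"
  assumes compact: "compact_space K" and Hausdorff: "Hausdorff_space K"
    and compact_factor: "\<And>i. i \<in> \<Gamma> \<Longrightarrow> compact_space (X i)"
    and metrizable_factor: "\<And>i. i \<in> \<Gamma> \<Longrightarrow> metrizable_space (X i)"
    and continuous: "\<And>i. i \<in> \<Gamma> \<Longrightarrow> continuous_map K (X i) (\<lambda>x. f x i)"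
    and separating: "\<And>x y. x \<in> topspace K \<Longrightarrow> y \<in> topspace K \<Longrightarrow> x \<noteq> y \<Longrightarrow> \<exists>i\<in>\<Gamma>. f x i \<noteq> f y i"
    and base_point: "\<And>i. i \<in> \<Gamma> \<Longrightarrow> a i \<in> topspace (X i)"
    and finite_support: "\<And>x. x \<in> topspace K \<Longrightarrow> finite {i \<in> \<Gamma>. f x i \<noteq> a i}"
begin

definition supp :: "'a \<Rightarrow> 'i set" where
  "supp x = {i \<in> \<Gamma>. f x i \<noteq> a i}"

lemma finite_supp: "x \<in> topspace K \<Longrightarrow> finite (supp x)"
  by (simp add: supp_def finite_support)

lemma openin_factor_minus: "i \<in> \<Gamma> \<Longrightarrow> openin (X i) (topspace (X i) - {a i})"
  using metrizable_factor metrizable_imp_Hausdorff_space base_point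
  by (metis closedin_Hausdorff_singleton openin_diff openin_topspace)

lemma openin_supp_superset:
  assumes "finite F" "F \<subseteq> \<Gamma>"
  shows "openin K {x \<in> topspace K. F \<subseteq> supp x}"
  using assms
proof (induction F rule: finite_induct)
  case (insert i F)
  then have i: "i \<in> \<Gamma>" by simp
  have "openin K {x \<in> topspace K. f x i \<in> topspace (X i) - {a i}}"
    using openin_continuous_map_preimage[OF continuous[OF i] openin_factor_minus[OF i]] .
  moreover have "openin K {x \<in> topspace K. F \<subseteq> supp x}" using insert by simp
  ultimately have "openin K ({x \<in> topspace K. f x i \<in> topspace (X i) - {a i}} \<inter> {x \<in> topspace K. F \<subseteq> supp x})"
    by (rule openin_Int)
  moreover have "{x \<in> topspace K. f x i \<in> topspace (X i) - {a i}} \<inter> {x \<in> topspace K. F \<subseteq> supp x} =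
      {x \<in> topspace K. insert i F \<subseteq> supp x}"
    using continuous_map_image_subset_topspace[OF continuous[OF i]] i by (auto simp: supp_def)
  ultimately show ?case by simp
qed simp

lemma closedin_supp_subset: "closedin K {x \<in> topspace K. supp x \<subseteq> F}"
proof -
  have "openin K (\<Union>i\<in>\<Gamma> - F. {x \<in> topspace K. {i} \<subseteq> supp x})"
    by (intro openin_Union) (use openin_supp_superset in blast)
  moreover have "topspace K - {x \<in> topspace K. supp x \<subseteq> F} = (\<Union>i\<in>\<Gamma> - F. {x \<in> topspace K. {i} \<subseteq> supp x})"
    by (auto simp: supp_def)
  ultimately show ?thesis unfolding closedin_def by auto
qed

lemma second_countable_supp:
  assumes F: "finite F"
  shows "second_countable (subtopology K {x \<in> topspace K. supp x \<subseteq> F})"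
proof -
  define Y where "Y = subtopology K {x \<in> topspace K. supp x \<subseteq> F}"
  have top: "topspace Y = {x \<in> topspace K. supp x \<subseteq> F}" by (auto simp: Y_def)
  have Y: "compact_space Y"
    unfolding Y_def using closedin_supp_subset compact closedin_compact_space compact_space_subtopology by blast
  define G where "G = F \<inter> \<Gamma>"
  have G: "finite G" "G \<subseteq> \<Gamma>" using F by (auto simp: G_def)
  define g where "g = (\<lambda>x. restrict (f x) G)"
  have g: "continuous_map Y (product_topology X G) g"
    unfolding continuous_map_componentwise
  proof (intro conjI ballI)
    show "g ` topspace Y \<subseteq> extensional G" by (auto simp: g_def)
    fix i assume i: "i \<in> G"
    then have "i \<in> \<Gamma>" using G by blast
    then have "continuous_map Y (X i) (\<lambda>x. f x i)"
      unfolding Y_def by (rule continuous_map_from_subtopology[OF continuous])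
    then show "continuous_map Y (X i) (\<lambda>x. g x i)" using i by (simp add: g_def)
  qed
  have inj: "inj_on g (topspace Y)"
  proof (rule inj_onI, rule ccontr)
    fix x y assume xy: "x \<in> topspace Y" "y \<in> topspace Y" "g x = g y" "x \<noteq> y"
    then obtain i where i: "i \<in> \<Gamma>" "f x i \<noteq> f y i" using separating unfolding top by blast
    then have "i \<in> supp x \<union> supp y" by (auto simp: supp_def)
    then have "i \<in> G" using xy i(1) unfolding top G_def by blast
    then show False using fun_cong[OF xy(3), of i] i(2) by (simp add: g_def)
  qed
  have met: "metrizable_space (product_topology X G)"
    unfolding metrizable_space_product_topology using G metrizable_factor
    by (auto intro: countable_finite)
  then have "embedding_map Y (product_topology X G) g"
    by (intro continuous_imp_embedding_map[OF g Y _ inj] metrizable_imp_Hausdorff_space)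
  then have "Y homeomorphic_space subtopology (product_topology X G) (g ` topspace Y)"
    unfolding embedding_map_def by (rule homeomorphic_map_imp_homeomorphic_space)
  then have "metrizable_space Y"
    by (rule homeomorphic_metrizable_space[THEN iffD2, OF _ metrizable_space_subtopology[OF met]])
  then show ?thesis
    using compact_metrizable_imp_second_countable[OF Y] by (simp only: Y_def)
qed

lemma closedin_card_supp_le: "closedin K {x \<in> topspace K. card (supp x) \<le> n}"
proof -
  have "openin K (\<Union>F\<in>{F. finite F \<and> F \<subseteq> \<Gamma> \<and> card F = Suc n}. {x \<in> topspace K. F \<subseteq> supp x})"
    by (intro openin_Union) (use openin_supp_superset in blast)
  moreover have "topspace K - {x \<in> topspace K. card (supp x) \<le> n} =
      (\<Union>F\<in>{F. finite F \<and> F \<subseteq> \<Gamma> \<and> card F = Suc n}. {x \<in> topspace K. F \<subseteq> supp x})" (is "?L = ?R")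
  proof
    show "?L \<subseteq> ?R"
    proof
      fix x assume "x \<in> ?L"
      then have x: "x \<in> topspace K" "Suc n \<le> card (supp x)" by auto
      from x(2) obtain F where "F \<subseteq> supp x" "card F = Suc n" "finite F"
        by (rule obtain_subset_with_card_n)
      moreover have "supp x \<subseteq> \<Gamma>" by (auto simp: supp_def)
      ultimately show "x \<in> ?R" using x(1) by blast
    qed
    show "?R \<subseteq> ?L"
    proof
      fix x assume "x \<in> ?R"
      then obtain F where F: "x \<in> topspace K" "F \<subseteq> supp x" "card F = Suc n" by blast
      then have "Suc n \<le> card (supp x)" using card_mono[OF finite_supp[OF F(1)] F(2)] by simp
      then show "x \<in> ?L" using F(1) by simp
    qed
  qed
  ultimately show ?thesis unfolding closedin_def by auto
qed

text \<open>
  By the Baire category theorem some relatively open nonempty subset \<open>W\<close> of the closure of \<open>A\<close> has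
  supports of bounded cardinality. Near a point \<open>x\<close> of \<open>W\<close> whose support is as large as possible,
  the points of \<open>W\<close> have supports that contain that of \<open>x\<close> and hence are equal to it. So a neighbourhood
  of \<open>x\<close> in \<open>W\<close> embeds into a finite product of metrizable factors; it meets \<open>A\<close> by density.
\<close>

lemma M_scattered: "M_scattered K"
  unfolding M_scattered_def
proof (intro allI impI, elim conjE)
  fix A assume A: "A \<subseteq> topspace K" "A \<noteq> {}"
  define L where "L = K closure_of A"
  have L: "closedin K L" "A \<subseteq> L" "L \<subseteq> topspace K"
    using A by (auto simp: L_def closure_of_subset closure_of_subset_topspace)
  define Y where "Y = subtopology K L"
  have topY: "topspace Y = L" unfolding Y_def using L(3) by (rule topspace_subtopology_subset)
  have Y: "compact_space Y" "Hausdorff_space Y"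
    unfolding Y_def using L(1) compact closedin_compact_space compact_space_subtopology
      Hausdorff Hausdorff_space_subtopology by blast+
  define C where "C = (\<lambda>n. L \<inter> {x \<in> topspace K. card (supp x) \<le> n})"
  have clC: "closedin Y (C n)" for n
    unfolding Y_def C_def using closedin_card_supp_le by (rule closedin_subtopology_Int_closed)
  have "\<exists>n. Y interior_of C n \<noteq> {}"
  proof (rule ccontr)
    assume *: "\<nexists>n. Y interior_of C n \<noteq> {}"
    have "Y interior_of \<Union>(range C) = {}"
    proof (rule Baire_category_alt)
      show "completely_metrizable_space Y \<or> locally_compact_space Y \<and> regular_space Y"
        using Y compact_imp_locally_compact_space compact_Hausdorff_imp_regular_space by blast
      show "closedin Y T \<and> Y interior_of T = {}" if "T \<in> range C" for T
        using that clC * by blast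
    qed simp
    moreover have "\<Union>(range C) = topspace Y"
      using L(3) unfolding topY C_def by blast
    ultimately show False using A(2) L(2) topY by (metis interior_of_topspace subset_empty)
  qed
  then obtain n where n: "Y interior_of C n \<noteq> {}" by blast
  define W where "W = Y interior_of C n"
  have W: "openin Y W" "W \<subseteq> C n" "W \<noteq> {}"
    using n by (auto simp: W_def interior_of_subset)
  obtain O' where O': "openin K O'" "W = O' \<inter> L"
    using W(1) unfolding Y_def openin_subtopology by blast
  have fin: "finite ((\<lambda>x. card (supp x)) ` W)"
    by (rule finite_subset[of _ "{..n}"]) (use W(2) in \<open>auto simp: C_def\<close>)
  then have "Max ((\<lambda>x. card (supp x)) ` W) \<in> (\<lambda>x. card (supp x)) ` W"
    using W(3) by (intro Max_in) auto
  then obtain x where x: "x \<in> W" "card (supp x) = Max ((\<lambda>x. card (supp x)) ` W)" by auto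
  have maxx: "card (supp y) \<le> card (supp x)" if "y \<in> W" for y
    unfolding x(2) using fin that by simp
  have xK: "x \<in> topspace K" using x(1) W(2) by (auto simp: C_def)
  define V where "V = O' \<inter> {y \<in> topspace K. supp x \<subseteq> supp y}"
  have opV: "openin K V"
    unfolding V_def using O'(1) openin_supp_superset[OF finite_supp[OF xK]]
    by (intro openin_Int) (auto simp: supp_def)
  have "x \<in> V" using x(1) O'(2) xK by (auto simp: V_def)
  moreover have "x \<in> K closure_of A" using x(1) O'(2) by (simp add: L_def)
  ultimately have ne: "V \<inter> A \<noteq> {}" using opV unfolding in_closure_of by blast
  have "V \<inter> A \<subseteq> {y \<in> topspace K. supp y \<subseteq> supp x}"
  proof
    fix y assume y: "y \<in> V \<inter> A"
    then have yK: "y \<in> topspace K" "supp x \<subseteq> supp y" by (auto simp: V_def)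
    have "y \<in> W" using y L(2) O'(2) by (auto simp: V_def)
    then have "card (supp y) \<le> card (supp x)" by (rule maxx)
    then have "supp x = supp y" using card_seteq[OF finite_supp[OF yK(1)] yK(2)] by simp
    then show "y \<in> {y \<in> topspace K. supp y \<subseteq> supp x}" using yK(1) by simp
  qed
  then have "second_countable (subtopology K (V \<inter> A))"
    by (rule second_countable_subspace_mono[OF second_countable_supp[OF finite_supp[OF xK]]])
  moreover have "openin (subtopology K A) (V \<inter> A)" using opV by (rule openin_subtopology_Int)
  ultimately show "\<exists>U. openin (subtopology K A) U \<and> U \<noteq> {} \<and> second_countable (subtopology K U)"
    using ne by (intro exI[of _ "V \<inter> A"] conjI)
qed

text \<open>
  The points with support exactly \<open>F\<close> form a Lindelof space, so they are covered by countably many members of the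
  given cover. These may be shrunk to the points whose support contains \<open>F\<close>. A point lies in such
  sets only for the finitely many subsets \<open>F\<close> of its own support.
\<close>

lemma hereditarily_metalindelof: "hereditarily metalindelof_space K"
  unfolding hereditarily_def
proof (intro allI impI)
  fix S assume S: "S \<subseteq> topspace K"
  show "metalindelof_space (subtopology K S)"
    unfolding metalindelof_space_def
  proof (intro allI impI, elim conjE)
    fix \<U> assume op: "\<forall>U\<in>\<U>. openin (subtopology K S) U" and cov: "\<Union>\<U> = topspace (subtopology K S)"
    have top: "topspace (subtopology K S) = S" using S by (rule topspace_subtopology_subset)
    define E where "E = (\<lambda>F. {x \<in> S. supp x = F})"
    have "\<exists>\<W>. countable \<W> \<and> \<W> \<subseteq> \<U> \<and> E F \<subseteq> \<Union>\<W>" if F: "finite F" for F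
    proof -
      have "E F \<subseteq> {x \<in> topspace K. supp x \<subseteq> F}" using S by (auto simp: E_def)
      then have "second_countable (subtopology K (E F))"
        by (rule second_countable_subspace_mono[OF second_countable_supp[OF F]])
      then have "Lindelof_space (subtopology K (E F))"
        by (rule second_countable_imp_Lindelof_space)
      moreover have ES: "E F \<subseteq> S" by (auto simp: E_def)
      ultimately have "Lindelof_space (subtopology (subtopology K S) (E F))"
        by (simp add: subtopology_subtopology Int_absorb1)
      moreover have "E F \<subseteq> topspace (subtopology K S)" "E F \<subseteq> \<Union>\<U>" using ES top cov by auto
      ultimately show ?thesis
        using op Lindelof_space_subtopology_subset[of "E F" "subtopology K S"] by blast
    qed
    then obtain \<W> where \<W>: "\<And>F. finite F \<Longrightarrow> countable (\<W> F)" "\<And>F. finite F \<Longrightarrow> \<W> F \<subseteq> \<U>"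
      "\<And>F. finite F \<Longrightarrow> E F \<subseteq> \<Union>(\<W> F)"
      by metis
    define up where "up = (\<lambda>F. {x \<in> topspace K. F \<subseteq> supp x})"
    define \<V> where "\<V> = (\<Union>F\<in>{F. finite F \<and> F \<subseteq> \<Gamma>}. (\<lambda>U. U \<inter> up F) ` \<W> F)"
    have "openin (subtopology K S) (U \<inter> up F)" if "finite F" "F \<subseteq> \<Gamma>" "U \<in> \<W> F" for U F
    proof -
      have "openin (subtopology K S) U" using op \<W>(2) that by blast
      then obtain T where "openin K T" "U = T \<inter> S" unfolding openin_subtopology by blast
      moreover have "openin K (up F)" unfolding up_def using openin_supp_superset that by blast
      ultimately have "openin K (T \<inter> up F)" "U \<inter> up F = (T \<inter> up F) \<inter> S" by auto
      then show ?thesis unfolding openin_subtopology by blast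
    qed
    then have opV: "\<forall>V\<in>\<V>. openin (subtopology K S) V" by (auto simp: \<V>_def)
    have refine: "\<forall>V\<in>\<V>. \<exists>U\<in>\<U>. V \<subseteq> U" using \<W>(2) unfolding \<V>_def by blast
    have "S \<subseteq> \<Union>\<V>"
    proof
      fix x assume x: "x \<in> S"
      then have F: "finite (supp x)" "supp x \<subseteq> \<Gamma>" using S finite_supp by (auto simp: supp_def)
      have "x \<in> E (supp x)" using x by (simp add: E_def)
      then obtain U where "U \<in> \<W> (supp x)" "x \<in> U" using \<W>(3)[OF F(1)] by blast
      moreover have "x \<in> up (supp x)" using x S by (auto simp: up_def)
      ultimately show "x \<in> \<Union>\<V>" unfolding \<V>_def using F by blast
    qed
    then have covV: "\<Union>\<V> = topspace (subtopology K S)"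
      using refine cov unfolding top by blast
    have "countable {V \<in> \<V>. x \<in> V}" if x: "x \<in> topspace (subtopology K S)" for x
    proof (rule countable_subset)
      have F: "finite (supp x)" using x finite_supp by simp
      show "{V \<in> \<V>. x \<in> V} \<subseteq> (\<Union>F\<in>Pow (supp x). (\<lambda>U. U \<inter> up F) ` \<W> F)"
        unfolding \<V>_def up_def by blast
      show "countable (\<Union>F\<in>Pow (supp x). (\<lambda>U. U \<inter> up F) ` \<W> F)"
      proof (rule countable_UN)
        show "countable (Pow (supp x))" using F by (simp add: countable_finite)
        show "countable ((\<lambda>U. U \<inter> up F) ` \<W> F)" if "F \<in> Pow (supp x)" for F
          using that F \<W>(1) finite_subset by blast
      qed
    qed
    then show "\<exists>\<V>. (\<forall>V\<in>\<V>. openin (subtopology K S) V) \<and> \<Union>\<V> = topspace (subtopology K S) \<and>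
        (\<forall>V\<in>\<V>. \<exists>U\<in>\<U>. V \<subseteq> U) \<and> (\<forall>x\<in>topspace (subtopology K S). countable {V \<in> \<V>. x \<in> V})"
      using opV covV refine by (intro exI[of _ \<V>]) simp
  qed
qed

text \<open>
  Each factor is replaced by countably many functions that vanish at the base point. The \<open>n\<close>-th one is
  scaled by \<open>1/(n+1)\<close>, so a point has values above a given \<open>\<epsilon>\<close> only for finitely many functions of each of the
  finitely many factors in its support.
\<close>

lemma Eberlein: "Eberlein_compact K"
proof -
  define good where "good = (\<lambda>i \<Phi>. countable \<Phi> \<and>
    (\<forall>g\<in>\<Phi>. continuous_map (X i) (top_of_set {0..1::real}) g \<and> g (a i) = 0) \<and>
    (\<forall>p\<in>topspace (X i). \<forall>q\<in>topspace (X i). p \<noteq> q \<longrightarrow> (\<exists>g\<in>\<Phi>. g p \<noteq> g q)))"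
  have "\<exists>\<Phi>. good i \<Phi>" if i: "i \<in> \<Gamma>" for i
  proof -
    (* Taking the complement of the base point both as piece and as neighbourhood, the functions
       vanish at the base point, so they separate it from the other points as well. *)
    let ?P = "topspace (X i) - {a i}"
    have "second_countable (X i)"
      using compact_metrizable_imp_second_countable compact_factor metrizable_factor i by blast
    then have sc: "second_countable (subtopology (X i) ?P)" by (rule second_countable_subtopology)
    have Hd: "Hausdorff_space (X i)" using metrizable_imp_Hausdorff_space metrizable_factor i by blast
    obtain \<Phi> :: "('b \<Rightarrow> real) set" where \<Phi>: "countable \<Phi>"
      "\<And>g. g \<in> \<Phi> \<Longrightarrow> continuous_map (X i) (top_of_set {0..1}) g"
      "\<And>g x. g \<in> \<Phi> \<Longrightarrow> x \<in> topspace (X i) - ?P \<Longrightarrow> g x = 0"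
      "\<And>p q. p \<in> ?P \<Longrightarrow> q \<in> topspace (X i) \<Longrightarrow> q \<noteq> p \<Longrightarrow> q \<in> ?P \<or> q \<notin> ?P \<Longrightarrow> \<exists>g\<in>\<Phi>. g p \<noteq> g q"
      using countable_separating_functions[OF compact_factor[OF i] Hd openin_factor_minus[OF i] order.refl sc]
      by blast
    have "\<exists>g\<in>\<Phi>. g p \<noteq> g q" if pq: "p \<in> topspace (X i)" "q \<in> topspace (X i)" "p \<noteq> q" for p q
    proof (cases "p = a i")
      case True
      then have "q \<in> ?P" using pq by simp
      then obtain g where "g \<in> \<Phi>" "g q \<noteq> g p" using \<Phi>(4)[of q p] pq by blast
      then show ?thesis by metis
    next
      case False
      then have "p \<in> ?P" using pq by simp
      then show ?thesis using \<Phi>(4)[of p q] pq by blast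
    qed
    then show ?thesis using \<Phi>(1-3) base_point[OF i] unfolding good_def by (intro exI[of _ \<Phi>]) simp
  qed
  then have "\<forall>i\<in>\<Gamma>. \<exists>\<Phi>. good i \<Phi>" by blast
  from bchoice[OF this] obtain \<Phi> where "\<forall>i\<in>\<Gamma>. good i (\<Phi> i)" ..
  then have \<Phi>: "\<And>i. i \<in> \<Gamma> \<Longrightarrow> countable (\<Phi> i)"
    "\<And>i g. i \<in> \<Gamma> \<Longrightarrow> g \<in> \<Phi> i \<Longrightarrow> continuous_map (X i) (top_of_set {0..1::real}) g"
    "\<And>i g. i \<in> \<Gamma> \<Longrightarrow> g \<in> \<Phi> i \<Longrightarrow> g (a i) = 0"
    "\<And>i p q. i \<in> \<Gamma> \<Longrightarrow> p \<in> topspace (X i) \<Longrightarrow> q \<in> topspace (X i) \<Longrightarrow> p \<noteq> q \<Longrightarrow> \<exists>g\<in>\<Phi> i. g p \<noteq> g q"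
    by (simp_all add: good_def)
  define w where "w = (\<lambda>(i,g). inverse (1 + real (to_nat_on (\<Phi> i) g)))"
  have w: "0 < w j" "w j \<le> 1" for j
    by (auto simp: w_def split_beta inverse_le_1_iff)
  define e where "e = (\<lambda>j x. w j * snd j (f x (fst j)))"
  have fX: "f x i \<in> topspace (X i)" if "x \<in> topspace K" "i \<in> \<Gamma>" for x i
    using continuous_map_image_subset_topspace[OF continuous[OF that(2)]] that(1) by blast
  have g01: "0 \<le> g (f x i)" "g (f x i) \<le> 1" if "i \<in> \<Gamma>" "g \<in> \<Phi> i" "x \<in> topspace K" for g x i
    using continuous_map_image_subset_topspace[OF \<Phi>(2)[OF that(1,2)]] fX[OF that(3,1)] by auto
  show ?thesis
  proof (rule Eberlein_compact_functionsI[OF compact Hausdorff, where e = e and I = "Sigma \<Gamma> \<Phi>"])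
    fix j assume "j \<in> Sigma \<Gamma> \<Phi>"
    then obtain i g where j: "j = (i,g)" "i \<in> \<Gamma>" "g \<in> \<Phi> i" by blast
    have "continuous_map K euclideanreal (g \<circ> (\<lambda>x. f x i))"
      using continuous_map_compose[OF continuous[OF j(2)] \<Phi>(2)[OF j(2,3)]]
      by (simp add: continuous_map_in_subtopology)
    then have "continuous_map K euclideanreal (e j)"
      unfolding e_def j(1) by (intro continuous_intros) (simp add: o_def)
    moreover have "e j x \<in> {0..1}" if "x \<in> topspace K" for x
      using g01[OF j(2,3) that] w[of j] unfolding e_def j(1) by (simp add: mult_le_one)
    ultimately show "continuous_map K (top_of_set {0..1}) (e j)"
      by (auto simp: continuous_map_in_subtopology)
  next
    fix x and \<epsilon> :: real assume x: "x \<in> topspace K" and \<epsilon>: "\<epsilon> > 0"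
    obtain N :: nat where N: "inverse \<epsilon> < real N" using reals_Archimedean2 by blast
    have "{j \<in> Sigma \<Gamma> \<Phi>. \<epsilon> < e j x} \<subseteq> (SIGMA i:supp x. to_nat_on (\<Phi> i) -` {..<N} \<inter> \<Phi> i)"
    proof clarify
      fix i g assume ig: "i \<in> \<Gamma>" "g \<in> \<Phi> i" "\<epsilon> < e (i,g) x"
      have "e (i,g) x \<le> w (i,g)"
        using g01[OF ig(1,2) x] w(1)[of "(i,g)"] unfolding e_def by (simp add: mult_left_le)
      then have "\<epsilon> < inverse (1 + real (to_nat_on (\<Phi> i) g))" using ig(3) by (simp add: w_def)
      then have "1 + real (to_nat_on (\<Phi> i) g) < inverse \<epsilon>"
        using \<epsilon> by (metis inverse_inverse_eq less_imp_inverse_less)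
      then have "to_nat_on (\<Phi> i) g < N" using N by linarith
      moreover have "f x i \<noteq> a i"
      proof
        assume "f x i = a i"
        then have "e (i,g) x = 0" using \<Phi>(3)[OF ig(1,2)] by (simp add: e_def)
        then show False using ig(3) \<epsilon> by simp
      qed
      ultimately show "i \<in> supp x \<and> g \<in> to_nat_on (\<Phi> i) -` {..<N} \<inter> \<Phi> i"
        using ig by (simp add: supp_def)
    qed
    moreover have "finite (SIGMA i:supp x. to_nat_on (\<Phi> i) -` {..<N} \<inter> \<Phi> i)"
    proof (rule finite_SigmaI[OF finite_supp[OF x]])
      fix i assume "i \<in> supp x"
      then have "countable (\<Phi> i)" using \<Phi>(1) by (simp add: supp_def)
      then show "finite (to_nat_on (\<Phi> i) -` {..<N} \<inter> \<Phi> i)"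
        by (intro finite_vimage_IntI inj_on_to_nat_on) simp_all
    qed
    ultimately show "finite {j \<in> Sigma \<Gamma> \<Phi>. \<epsilon> < e j x}" by (rule finite_subset)
  next
    fix x y assume xy: "x \<in> topspace K" "y \<in> topspace K" "x \<noteq> y"
    then obtain i where i: "i \<in> \<Gamma>" "f x i \<noteq> f y i" using separating by blast
    then obtain g where g: "g \<in> \<Phi> i" "g (f x i) \<noteq> g (f y i)"
      using \<Phi>(4)[OF i(1) fX[OF xy(1) i(1)] fX[OF xy(2) i(1)]] by blast
    then have "e (i,g) x \<noteq> e (i,g) y" using w(1)[of "(i,g)"] by (simp add: e_def)
    then show "\<exists>j\<in>Sigma \<Gamma> \<Phi>. e j x \<noteq> e j y" using i(1) g(1) by blast
  qed
qed

end

lemma NY_compact_sigma_embedding: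
  fixes K :: "'a topology"
  assumes "NY_compact K"
  obtains \<Gamma> :: "('a \<Rightarrow> real) set" and X :: "('a \<Rightarrow> real) \<Rightarrow> real topology" and a f
  where "sigma_embedding K \<Gamma> X a f"
proof -
  obtain \<Gamma> :: "('a \<Rightarrow> real) set" and X :: "('a \<Rightarrow> real) \<Rightarrow> real topology" and a f where
    K: "compact_space K" "Hausdorff_space K"
    and X: "\<forall>i\<in>\<Gamma>. compact_space (X i) \<and> metrizable_space (X i)"
    and a: "a \<in> topspace (product_topology X \<Gamma>)"
    and emb: "embedding_map K (sigma_product \<Gamma> X a) f"
    using assms unfolding NY_compact_def by blast
  have f: "embedding_map K (product_topology X \<Gamma>) f"
    and fin: "\<And>x. x \<in> topspace K \<Longrightarrow> finite {i \<in> \<Gamma>. f x i \<noteq> a i}"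
    using emb by (auto simp: sigma_product_def embedding_map_in_subtopology image_subset_iff)
  have cf: "continuous_map K (product_topology X \<Gamma>) f" and injf: "inj_on f (topspace K)"
    using f by (auto simp: embedding_map_def homeomorphic_eq_everything_map continuous_map_in_subtopology)
  have ext: "f x \<in> extensional \<Gamma>" if "x \<in> topspace K" for x
    using cf that by (auto simp: continuous_map_componentwise)
  have "sigma_embedding K \<Gamma> X a f"
  proof
    show "\<exists>i\<in>\<Gamma>. f x i \<noteq> f y i" if "x \<in> topspace K" "y \<in> topspace K" "x \<noteq> y" for x y
      using injf that ext by (metis extensionalityI inj_onD)
    show "continuous_map K (X i) (\<lambda>x. f x i)" if "i \<in> \<Gamma>" for i
      using cf that by (simp add: continuous_map_componentwise)
    show "a i \<in> topspace (X i)" if "i \<in> \<Gamma>" for i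
      using a that by (auto simp: PiE_iff)
    show "compact_space (X i)" "metrizable_space (X i)" if "i \<in> \<Gamma>" for i
      using X that by blast+
  qed (rule K fin, assumption?)+
  then show thesis by (rule that)
qed

section \<open>The equivalence\<close>

theorem theorem3p4:
  fixes K :: "'a topology"
  assumes "compact_space K" and "Hausdorff_space K"
  shows "(NY_compact K \<longleftrightarrow> Corson_compact K \<and> M_scattered K) \<and>
         (NY_compact K \<longleftrightarrow> Eberlein_compact K \<and> M_scattered K) \<and>
         (NY_compact K \<longleftrightarrow> hereditarily metalindelof_space K \<and> M_scattered K)"
proof -
  have "Eberlein_compact K \<and> M_scattered K \<and> hereditarily metalindelof_space K" if NY: "NY_compact K"
  proof -
    obtain \<Gamma> :: "('a \<Rightarrow> real) set" and X :: "('a \<Rightarrow> real) \<Rightarrow> real topology" and a f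
      where "sigma_embedding K \<Gamma> X a f"
      using NY by (rule NY_compact_sigma_embedding)
    then interpret sigma_embedding K \<Gamma> X a f .
    show ?thesis using Eberlein M_scattered hereditarily_metalindelof by blast
  qed
  then show ?thesis
    using Eberlein_imp_Corson[of K] hereditarily_metalindelof_imp_Corson[OF assms]
      Corson_M_scattered_imp_NY[OF assms]
    by blast
qed

end
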